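(* Let $A$ be a closed densely defined symmetric operator with equal deficiency indices in a separable Hilbert space $\mathfrak H$, let $\{\mathcal H,\Gamma_0,\Gamma_1\}$ be a boundary triplet for $A^*$, let $B_1,B_2\in\mathcal C(\mathcal H)$, let $z_0\in\rho(A_{B_1})\cap\rho(A_{B_2})$, and let $\zeta\in\rho(B_1)\cap\rho(B_2)$. Suppose that $(A_{B_1}-z_0)^{-1}$ is compact and $$\lim_{n\to\infty}n^\alpha s_n\big((A_{B_1}-z_0)^{-1}\big)=a\quad\text{for some }\alpha>0,\ a>0.$$ If $$\lim_{n\to\infty}n^\alpha s_n\big((B_1-\zeta)^{-1}-(B_2-\zeta)^{-1}\big)=0,$$ then $$\lim_{n\to\infty}n^\alpha s_n\big((A_{B_2}-z_0)^{-1}\big)=a.$$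
   Context: $\mathcal C(\mathcal H)$ denotes the closed densely defined operators in $\mathcal H$. $s_n(T)$ are the singular numbers (eigenvalues of $(T^*T)^{1/2}$ in nonincreasing order, counting multiplicity) of a compact operator $T$; the limit hypothesis on $(B_1-\zeta)^{-1}-(B_2-\zeta)^{-1}$ includes that this operator is compact, and $s_n=0$ beyond the rank of the operator. A boundary triplet for $A^*$ is a triple $\{\mathcal H,\Gamma_0,\Gamma_1\}$, where $\mathcal H$ is a Hilbert space and $\Gamma_0,\Gamma_1:\operatorname{dom}(A^* )\to\mathcal H$ are linear maps such that (i) $(A^*f,g)_{\mathfrak H}-(f,A^*g)_{\mathfrak H}=(\Gamma_1f,\Gamma_0g)_{\mathcal H}-(\Gamma_0f,\Gamma_1g)_{\mathcal H}$ for all $f,g\in\operatorname{dom}(A^* )$, and (ii) $f\mapsto(\Gamma_1f,\Gamma_0f)$ maps $\operatorname{dom}(A^* )$ onto $\mathcal H\oplus\mathcal H$. For $B\in\mathcal C(\mathcal H)$, $A_B$ is the restriction of $A^*$ to $\{f\in\operatorname{dom}(A^* ):\Gamma_0f\in\operatorname{dom}(B),\ \Gamma_1f=B\Gamma_0f\}$. *)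

theory Defs
  imports "HOL-Analysis.Analysis" "HOL-Library.Equipollence"
begin

section \<open>Complex Hilbert spaces\<close>

text \<open>
  A complex inner product space is a real inner product space together with a complex scalar
  multiplication and a sesquilinear form (linear in the first argument) whose real part is the
  real inner product.  The norm, the metric and the positive definiteness of the form are
  inherited from \<^class>\<open>real_inner\<close>.
\<close>

class complex_inner = real_inner +
  fixes scaleC :: "complex \<Rightarrow> 'a \<Rightarrow> 'a"  (infixr \<open>*\<^sub>C\<close> 75)
    and cinner :: "'a \<Rightarrow> 'a \<Rightarrow> complex"
  assumes scaleC_add_right: "c *\<^sub>C (x + y) = c *\<^sub>C x + c *\<^sub>C y"
    and scaleC_add_left: "(c + d) *\<^sub>C x = c *\<^sub>C x + d *\<^sub>C x"
    and scaleC_scaleC: "c *\<^sub>C (d *\<^sub>C x) = (c * d) *\<^sub>C x"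
    and scaleC_complex_of_real: "complex_of_real r *\<^sub>C x = r *\<^sub>R x"
    and cinner_commute: "cinner x y = cnj (cinner y x)"
    and cinner_add_left: "cinner (x + y) z = cinner x z + cinner y z"
    and cinner_scaleC_left: "cinner (c *\<^sub>C x) y = c * cinner x y"
    and Re_cinner: "Re (cinner x y) = inner x y"

class chilbert_space = complex_inner + banach

interpretation complex_vector: vector_space "scaleC :: complex \<Rightarrow> 'a \<Rightarrow> 'a::complex_inner"
proof
  fix x :: 'a
  show "1 *\<^sub>C x = x"
    using scaleC_complex_of_real[of 1 x] by simp
qed (simp_all add: scaleC_add_right scaleC_add_left scaleC_scaleC)

instantiation prod :: (complex_inner, complex_inner) complex_inner
begin

definition scaleC_prod :: "complex \<Rightarrow> 'a \<times> 'b \<Rightarrow> 'a \<times> 'b"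
  where "scaleC_prod c p = (c *\<^sub>C fst p, c *\<^sub>C snd p)"

definition cinner_prod :: "'a \<times> 'b \<Rightarrow> 'a \<times> 'b \<Rightarrow> complex"
  where "cinner_prod p q = cinner (fst p) (fst q) + cinner (snd p) (snd q)"

instance
proof
  fix x y z :: "'a \<times> 'b" and c d :: complex and r :: real
  show "c *\<^sub>C (x + y) = c *\<^sub>C x + c *\<^sub>C y"
    by (simp add: scaleC_prod_def scaleC_add_right)
  show "(c + d) *\<^sub>C x = c *\<^sub>C x + d *\<^sub>C x"
    by (simp add: scaleC_prod_def scaleC_add_left)
  show "c *\<^sub>C (d *\<^sub>C x) = (c * d) *\<^sub>C x"
    by (simp add: scaleC_prod_def scaleC_scaleC)
  show "complex_of_real r *\<^sub>C x = r *\<^sub>R x"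
    by (simp add: scaleC_prod_def scaleC_complex_of_real scaleR_prod_def)
  show "cinner x y = cnj (cinner y x)"
    unfolding cinner_prod_def
    by (subst (1 2) cinner_commute) simp
  show "cinner (x + y) z = cinner x z + cinner y z"
    by (simp add: cinner_prod_def cinner_add_left)
  show "cinner (c *\<^sub>C x) y = c * cinner x y"
    by (simp add: cinner_prod_def scaleC_prod_def cinner_scaleC_left distrib_left)
  show "Re (cinner x y) = inner x y"
    by (simp add: cinner_prod_def inner_prod_def Re_cinner)
qed

end

instance prod :: (chilbert_space, chilbert_space) chilbert_space ..

text \<open>Two closed subspaces have the same Hilbert space dimension (finite or infinite) iff they
  have orthonormal bases of the same cardinality.\<close>

definition orthonormal_basis :: "'a::complex_inner set \<Rightarrow> 'a set \<Rightarrow> bool" where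
  "orthonormal_basis E M \<longleftrightarrow>
     E \<subseteq> M \<and> (\<forall>x\<in>E. \<forall>y\<in>E. cinner x y = (if x = y then 1 else 0)) \<and>
     M \<subseteq> closure (complex_vector.span E)"

definition same_hilbert_dim :: "'a::complex_inner set \<Rightarrow> 'a set \<Rightarrow> bool" where
  "same_hilbert_dim M N \<longleftrightarrow>
     (\<exists>E F. orthonormal_basis E M \<and> orthonormal_basis F N \<and> E \<approx> F)"


section \<open>Unbounded operators\<close>

text \<open>
  A possibly unbounded linear operator \<open>T\<close>, defined on a subspace, is identified with its graph:
  \<open>(f, g) \<in> T\<close> means that \<open>f\<close> lies in the domain of \<open>T\<close> and \<open>T f = g\<close>.  Its domain is
  \<^term>\<open>Domain T\<close>.
\<close>

type_synonym 'a graph = "('a \<times> 'a) set"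

definition operator :: "'a::complex_inner graph \<Rightarrow> bool" where
  "operator T \<longleftrightarrow> complex_vector.subspace T \<and> single_valued T"

definition densely_defined :: "'a::complex_inner graph \<Rightarrow> bool" where
  "densely_defined T \<longleftrightarrow> closure (Domain T) = UNIV"

text \<open>The class \<open>\<C>(\<H>)\<close>; an operator is closed iff its graph is a closed set.\<close>

definition closed_dd_operators :: "'a::complex_inner graph set" where
  "closed_dd_operators = {T. operator T \<and> closed T \<and> densely_defined T}"

text \<open>For densely defined \<open>T\<close> this relation is single valued: it is the graph of \<open>T\<^sup>*\<close>.\<close>

definition adjoint_op :: "'a::complex_inner graph \<Rightarrow> 'a graph" where
  "adjoint_op T = {(g, h). \<forall>(f, k)\<in>T. cinner k g = cinner f h}"

definition symmetric_op :: "'a::complex_inner graph \<Rightarrow> bool" where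
  "symmetric_op T \<longleftrightarrow> (\<forall>(f, h)\<in>T. \<forall>(g, k)\<in>T. cinner h g = cinner f k)"

text \<open>The kernel of \<open>T\<^sup>* - z\<close>.\<close>

definition defect_space :: "'a::complex_inner graph \<Rightarrow> complex \<Rightarrow> 'a set" where
  "defect_space T z = {g. (g, z *\<^sub>C g) \<in> adjoint_op T}"

definition equal_deficiency_indices :: "'a::complex_inner graph \<Rightarrow> bool" where
  "equal_deficiency_indices T \<longleftrightarrow>
     same_hilbert_dim (defect_space T \<i>) (defect_space T (- \<i>))"

definition bounded_clinear :: "('a::complex_inner \<Rightarrow> 'b::complex_inner) \<Rightarrow> bool" where
  "bounded_clinear S \<longleftrightarrow> bounded_linear S \<and> (\<forall>c x. S (c *\<^sub>C x) = c *\<^sub>C S x)"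

text \<open>\<open>(T - z) f = h\<close> means \<open>(f, h + z f) \<in> T\<close>.  Off the resolvent set the value of
  \<open>resolvent T z\<close> is meaningless.\<close>

definition resolvent :: "'a::complex_inner graph \<Rightarrow> complex \<Rightarrow> 'a \<Rightarrow> 'a" where
  "resolvent T z h = (THE f. (f, h + z *\<^sub>C f) \<in> T)"

definition resolvent_set :: "'a::complex_inner graph \<Rightarrow> complex set" where
  "resolvent_set T =
     {z. (\<forall>h. \<exists>!f. (f, h + z *\<^sub>C f) \<in> T) \<and> bounded_clinear (resolvent T z)}"


section \<open>Singular numbers of compact operators\<close>

definition compact_op :: "('a::complex_inner \<Rightarrow> 'b::complex_inner) \<Rightarrow> bool" where
  "compact_op S \<longleftrightarrow> bounded_clinear S \<and> (\<forall>X. bounded X \<longrightarrow> compact (closure (S ` X)))"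

definition bounded_adjoint :: "('a::complex_inner \<Rightarrow> 'a) \<Rightarrow> 'a \<Rightarrow> 'a" where
  "bounded_adjoint S = (THE R. \<forall>x y. cinner (S x) y = cinner x (R y))"

definition positive_op :: "('a::complex_inner \<Rightarrow> 'a) \<Rightarrow> bool" where
  "positive_op S \<longleftrightarrow>
     bounded_clinear S \<and> (\<forall>x. cinner (S x) x \<in> \<real> \<and> 0 \<le> Re (cinner (S x) x))"

text \<open>\<open>(S\<^sup>* S)\<^sup>1\<^sup>/\<^sup>2\<close>\<close>

definition abs_op :: "('a::complex_inner \<Rightarrow> 'a) \<Rightarrow> 'a \<Rightarrow> 'a" where
  "abs_op S = (THE R. positive_op R \<and> R \<circ> R = bounded_adjoint S \<circ> S)"

definition eigenspace :: "('a::complex_inner \<Rightarrow> 'a) \<Rightarrow> complex \<Rightarrow> 'a set" where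
  "eigenspace S \<mu> = {x. S x = \<mu> *\<^sub>C x}"

text \<open>
  \<open>s\<close>, indexed from \<open>0\<close>, lists the positive eigenvalues of the operator \<open>R\<close> in nonincreasing order,
  each as often as its multiplicity, and is continued by \<open>0\<close> if there are only finitely many.
  The finiteness clause is needed because \<^const>\<open>card\<close> is \<open>0\<close> on infinite sets.  No element of an
  infinite list of eigenvalues can be \<open>0\<close>, since every positive eigenvalue must occur.
\<close>

definition eigenvalue_list :: "('a::complex_inner \<Rightarrow> 'a) \<Rightarrow> (nat \<Rightarrow> real) \<Rightarrow> bool" where
  "eigenvalue_list R s \<longleftrightarrow>
     decseq s \<and> (\<forall>n. 0 \<le> s n) \<and>
     (\<forall>\<mu>>0. finite {n. s n = \<mu>} \<and>
        card {n. s n = \<mu>} = complex_vector.dim (eigenspace R (complex_of_real \<mu>)))"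

text \<open>The numbering starts with \<open>s\<^sub>1\<close>; \<open>singular_number S 0\<close> is a dummy.\<close>

definition singular_number :: "('a::complex_inner \<Rightarrow> 'a) \<Rightarrow> nat \<Rightarrow> real" where
  "singular_number S n = (THE s. eigenvalue_list (abs_op S) s) (n - 1)"


section \<open>Boundary triplets\<close>

text \<open>
  The boundary space is the type \<open>'k\<close>.  The maps \<open>\<Gamma>0\<close>, \<open>\<Gamma>1\<close> are only relevant on the domain of
  \<open>A\<^sup>*\<close>.
\<close>

definition boundary_triplet ::
    "'h::chilbert_space graph \<Rightarrow> ('h \<Rightarrow> 'k::chilbert_space) \<Rightarrow> ('h \<Rightarrow> 'k) \<Rightarrow> bool" where
  "boundary_triplet A \<Gamma>0 \<Gamma>1 \<longleftrightarrow>
     (\<forall>\<Gamma>\<in>{\<Gamma>0, \<Gamma>1}. \<forall>f\<in>Domain (adjoint_op A). \<forall>g\<in>Domain (adjoint_op A). \<forall>c.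
        \<Gamma> (f + g) = \<Gamma> f + \<Gamma> g \<and> \<Gamma> (c *\<^sub>C f) = c *\<^sub>C \<Gamma> f) \<and>
     (\<forall>(f, f')\<in>adjoint_op A. \<forall>(g, g')\<in>adjoint_op A.
        cinner f' g - cinner f g' = cinner (\<Gamma>1 f) (\<Gamma>0 g) - cinner (\<Gamma>0 f) (\<Gamma>1 g)) \<and>
     (\<lambda>f. (\<Gamma>1 f, \<Gamma>0 f)) ` Domain (adjoint_op A) = UNIV"

text \<open>The restriction \<open>A\<^sub>B\<close> of \<open>A\<^sup>*\<close> to the \<open>f\<close> with \<open>\<Gamma>0 f \<in> dom B\<close> and \<open>\<Gamma>1 f = B (\<Gamma>0 f)\<close>.\<close>

definition extension_op ::
    "'h::chilbert_space graph \<Rightarrow> ('h \<Rightarrow> 'k::chilbert_space) \<Rightarrow> ('h \<Rightarrow> 'k) \<Rightarrow> 'k graph \<Rightarrow> 'h graph" where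
  "extension_op A \<Gamma>0 \<Gamma>1 B = {(f, g) \<in> adjoint_op A. (\<Gamma>0 f, \<Gamma>1 f) \<in> B}"

end

theory Submission
  imports Defs
begin

text \<open>
  Green's identity turns the resolvent difference of \<open>A\<^bsub>B1\<^esub>\<close> and \<open>A\<^bsub>B2\<^esub>\<close> into
  \<open>X ((B1 - \<zeta>)\<^sup>-\<^sup>1 - (B2 - \<zeta>)\<^sup>-\<^sup>1) Y\<close>, where \<open>Y h\<close> and \<open>X\<^sup>* k\<close> are the combinations
  \<open>\<Gamma>1 f - \<zeta> \<Gamma>0 f\<close> and \<open>\<Gamma>1 g - cnj \<zeta> \<Gamma>0 g\<close> of the boundary values of
  \<open>f = (A\<^bsub>B2\<^esub> - z)\<^sup>-\<^sup>1 h\<close> and \<open>g = ((A\<^bsub>B1\<^esub> - z)\<^sup>-\<^sup>1)\<^sup>* k\<close>; both are bounded by the uniform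
  boundedness principle.  Hence the singular numbers of the resolvent difference are \<open>o(n\<^sup>-\<^sup>\<alpha>)\<close>.
  Since singular numbers are approximation numbers, they satisfy the Ky Fan inequality
  \<open>s\<^bsub>m+n-1\<^esub>(S + T) \<le> s\<^sub>m(S) + s\<^sub>n(T)\<close>, and such a perturbation does not change the
  leading term of their asymptotics.
\<close>

section \<open>Complex inner product spaces\<close>

text \<open>Both \<open>abs_op\<close> and the eigenvalue list are definite descriptions, so
  \<open>singular_number\<close> says nothing until existence and uniqueness of each are
  established. One construction serves all of this: vectors that successively maximise
  \<open>norm (S x)\<close>. Their values \<open>\<sigma> n\<close> yield the spectral series of the
  modulus, the multiplicities of its eigenvalues and the optimal approximations of finite rank. The
  difference of the boundary resolvents appears for the following reason. The boundary values of
  \<open>f\<close> lie in \<open>B2\<close> and those of \<open>g\<close> in the adjoint of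
  \<open>B1\<close>. Subtracting \<open>\<zeta>\<close> from one and \<open>cnj \<zeta>\<close> from
  the other leaves the boundary form in Green's identity unchanged, but turns
  \<open>\<Gamma>0 f\<close> into the resolvent of \<open>B2\<close> at \<open>Y h\<close>, and
  moves the resolvent of \<open>B1\<close> onto \<open>Y h\<close> in the other term. The limit
  \<open>a\<close> survives because giving up about \<open>\<delta> n\<close> indices changes the
  main term only by a factor \<open>(1 + \<delta>) powr (- \<alpha>)\<close> or
  \<open>(1 - \<delta>) powr (- \<alpha>)\<close>, and \<open>\<delta>\<close> is arbitrary.\<close>

lemma cinner_add_right: "cinner x (y + z) = cinner x y + cinner x z"
  by (subst (1 2 3) cinner_commute) (simp add: cinner_add_left)

lemma cinner_scaleC_right: "cinner x (c *\<^sub>C y) = cnj c * cinner x y"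
  by (subst (1 2) cinner_commute) (simp add: cinner_scaleC_left)

lemma scaleC_minus_one: "(- 1) *\<^sub>C x = - (x::'a::complex_inner)"
  using scaleC_complex_of_real[of "-1" x] by simp

lemma cinner_minus_left: "cinner (- x) y = - cinner x y"
  using cinner_scaleC_left[of "-1" x y] by (simp add: scaleC_minus_one)

lemma cinner_minus_right: "cinner x (- y) = - cinner x y"
  using cinner_scaleC_right[of x "-1" y] by (simp add: scaleC_minus_one)

lemma cinner_diff_left: "cinner (x - y) z = cinner x z - cinner y z"
  using cinner_add_left[of x "- y" z] by (simp add: cinner_minus_left)

lemma cinner_diff_right: "cinner x (y - z) = cinner x y - cinner x z"
  using cinner_add_right[of x y "- z"] by (simp add: cinner_minus_right)

lemma cinner_zero_left [simp]: "cinner 0 y = 0"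
  using cinner_add_left[of 0 0 y] by simp

lemma cinner_zero_right [simp]: "cinner x 0 = 0"
  using cinner_add_right[of x 0 0] by simp

lemma cinner_sum_left: "cinner (sum f I) y = (\<Sum>i\<in>I. cinner (f i) y)"
  by (induction I rule: infinite_finite_induct) (simp_all add: cinner_add_left)

lemma cinner_self: "cinner x x = complex_of_real ((norm x)\<^sup>2)"
proof -
  have "Im (cinner x x) = 0"
    using arg_cong[OF cinner_commute[of x x], of Im] by simp
  then show ?thesis
    by (simp add: complex_eq_iff Re_cinner power2_norm_eq_inner)
qed

lemma norm_scaleC: "norm (c *\<^sub>C x) = cmod c * norm (x::'a::complex_inner)"
proof -
  have "complex_of_real ((norm (c *\<^sub>C x))\<^sup>2) = (c * cnj c) * complex_of_real ((norm x)\<^sup>2)"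
    by (simp only: cinner_self[symmetric] cinner_scaleC_left cinner_scaleC_right mult_ac)
  also have "\<dots> = complex_of_real ((cmod c * norm x)\<^sup>2)"
    by (simp add: complex_norm_square[symmetric] power_mult_distrib)
  finally have "(norm (c *\<^sub>C x))\<^sup>2 = (cmod c * norm x)\<^sup>2"
    using of_real_eq_iff by blast
  then show ?thesis
    by (simp add: power2_eq_iff_nonneg)
qed

lemma cmod_cinner_le: "cmod (cinner x y) \<le> norm x * norm y"
proof -
  \<comment> \<open>The phase \<open>u\<close> rotates the inner product onto the nonnegative reals,
    where real Cauchy-Schwarz applies.\<close>
  obtain u where u: "cmod u = 1" "u * cinner x y = complex_of_real (cmod (cinner x y))"
  proof (cases "cinner x y = 0")
    case False
    then show ?thesis
      by (intro that[of "complex_of_real (cmod (cinner x y)) / cinner x y"])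
        (simp_all add: norm_divide)
  qed (auto intro: that[of 1])
  have "cmod (cinner x y) = inner (u *\<^sub>C x) y"
    using arg_cong[OF u(2), of Re] by (simp add: cinner_scaleC_left[symmetric] Re_cinner)
  also have "\<dots> \<le> norm x * norm y"
    using norm_cauchy_schwarz[of "u *\<^sub>C x" y] by (simp add: norm_scaleC u)
  finally show ?thesis .
qed

lemma cinner_eqI:
  assumes "\<And>y. cinner x y = cinner x' y"
  shows "x = x'"
proof -
  have "cinner (x - x') (x - x') = 0"
    by (simp add: cinner_diff_left assms)
  then show ?thesis
    by (simp add: cinner_self)
qed

lemma cinner_eq_rightI:
  assumes "\<And>x. cinner x y = cinner x y'"
  shows "y = y'"
  by (rule cinner_eqI) (metis assms cinner_commute)

lemma scaleR_scaleC: "r *\<^sub>R x = complex_of_real r *\<^sub>C (x::'a::complex_inner)"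
  by (simp add: scaleC_complex_of_real)

lemma bounded_linear_scaleC_right: "bounded_linear (\<lambda>x::'a::complex_inner. c *\<^sub>C x)"
proof (rule bounded_linear_intro)
  show "norm (c *\<^sub>C x) \<le> norm x * cmod c" for x :: 'a
    by (simp add: norm_scaleC)
qed (simp_all add: scaleC_add_right scaleR_scaleC scaleC_scaleC mult.commute)

lemma bounded_linear_cinner_left: "bounded_linear (\<lambda>x. cinner x y)"
proof (rule bounded_linear_intro)
  show "norm (cinner x y) \<le> norm x * norm y" for x
    by (rule cmod_cinner_le)
qed (simp_all add: cinner_add_left scaleR_scaleC cinner_scaleC_left scaleR_conv_of_real)

lemmas tendsto_cinner_left = bounded_linear.tendsto[OF bounded_linear_cinner_left]
lemmas tendsto_scaleC_right = bounded_linear.tendsto[OF bounded_linear_scaleC_right]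

lemma bounded_clinear_bounded_linear: "bounded_clinear S \<Longrightarrow> bounded_linear S"
  by (simp add: bounded_clinear_def)

lemma bounded_clinear_add: "bounded_clinear S \<Longrightarrow> S (x + y) = S x + S y"
  and bounded_clinear_diff: "bounded_clinear S \<Longrightarrow> S (x - y) = S x - S y"
  and bounded_clinear_scaleC: "bounded_clinear S \<Longrightarrow> S (c *\<^sub>C x) = c *\<^sub>C S x"
  and bounded_clinear_zero: "bounded_clinear S \<Longrightarrow> S 0 = 0"
  and bounded_clinear_sum: "bounded_clinear S \<Longrightarrow> S (sum f I) = (\<Sum>i\<in>I. S (f i))"
  by (auto simp: bounded_clinear_def bounded_linear.linear linear_add linear_diff linear_0 linear_sum)

lemma bounded_clinear_tendsto:
  "bounded_clinear S \<Longrightarrow> (f \<longlongrightarrow> l) F \<Longrightarrow> ((\<lambda>n. S (f n)) \<longlongrightarrow> S l) F"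
  by (simp add: bounded_clinear_def bounded_linear.tendsto)

lemma bounded_clinear_bound:
  assumes "bounded_clinear S"
  obtains K where "K > 0" "\<And>x. norm (S x) \<le> K * norm x"
  using bounded_linear.pos_bounded[OF bounded_clinear_bounded_linear[OF assms]]
  by (metis mult.commute)

lemma bounded_clinearI:
  assumes "\<And>x y. S (x + y) = S x + S y" "\<And>c x. S (c *\<^sub>C x) = c *\<^sub>C S x"
    and "\<And>x. norm (S x) \<le> K * norm x"
  shows "bounded_clinear S"
  unfolding bounded_clinear_def
proof
  show "bounded_linear S"
    by (rule bounded_linear_intro[where K = K])
      (use assms in \<open>simp_all add: scaleR_scaleC mult.commute\<close>)
qed (use assms in auto)

lemma bounded_clinear_compose:
  "bounded_clinear S \<Longrightarrow> bounded_clinear T \<Longrightarrow> bounded_clinear (\<lambda>x. S (T x))"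
  by (auto simp: bounded_clinear_def intro: bounded_linear_compose)

lemma bounded_clinear_plus:
  "bounded_clinear S \<Longrightarrow> bounded_clinear T \<Longrightarrow> bounded_clinear (\<lambda>x. S x + T x)"
  by (auto simp: bounded_clinear_def scaleC_add_right intro: bounded_linear_add)

lemma bounded_clinear_minus:
  "bounded_clinear S \<Longrightarrow> bounded_clinear T \<Longrightarrow> bounded_clinear (\<lambda>x. S x - T x)"
  by (auto simp: bounded_clinear_def complex_vector.scale_right_diff_distrib
      intro: bounded_linear_sub)

lemma bounded_clinear_clinear:
  "bounded_clinear S \<Longrightarrow> Vector_Spaces.linear scaleC scaleC S"
  by (intro Vector_Spaces.linear.intro complex_vector.vector_space_axioms
      module_hom.intro module_hom_axioms.intro complex_vector.module_axioms)
    (simp_all add: bounded_clinear_add bounded_clinear_scaleC)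

text \<open>Only multiples of the one vector \<open>x\<close> enter the hypotheses, so the lemma
  serves bounds on a subspace as well as on the whole space.\<close>

lemma homogeneous_bound:
  fixes W :: "'a::complex_inner \<Rightarrow> 'b::complex_inner"
  assumes scale: "\<And>c. W (c *\<^sub>C x) = c *\<^sub>C W x"
    and bound: "\<And>c. norm (c *\<^sub>C x) \<le> 1 \<Longrightarrow> norm (W (c *\<^sub>C x)) \<le> M"
  shows "norm (W x) \<le> M * norm x"
proof (cases "x = 0")
  case True
  then show ?thesis using scale[of 0] by simp
next
  case False
  have "norm (W (complex_of_real (1 / norm x) *\<^sub>C x)) \<le> M"
    using False by (intro bound) (simp only: norm_scaleC norm_of_real, simp)
  then have "\<bar>1 / norm x\<bar> * norm (W x) \<le> M"
    by (simp only: scale norm_scaleC norm_of_real)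
  then show ?thesis
    using False by (simp add: field_simps)
qed

section \<open>Riesz representation, adjoints and uniform boundedness\<close>

lemma parallelogram_law:
  fixes x y :: "'a::real_inner"
  shows "(norm (x + y))\<^sup>2 + (norm (x - y))\<^sup>2 = 2 * (norm x)\<^sup>2 + 2 * (norm y)\<^sup>2"
  by (simp add: power2_norm_eq_inner inner_add inner_diff)

text \<open>The representing vector minimises \<open>\<parallel>x\<parallel>\<^sup>2 - 2 \<phi> x\<close>.\<close>

lemma riesz_real:
  fixes \<phi> :: "'a::{real_inner,banach} \<Rightarrow> real"
  assumes "bounded_linear \<phi>"
  obtains a where "\<And>x. \<phi> x = inner x a"
proof -
  interpret \<phi>: bounded_linear \<phi> by fact
  define J where "J x = (norm x)\<^sup>2 - 2 * \<phi> x" for x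
  obtain K where K: "\<And>x. norm (\<phi> x) \<le> norm x * K"
    using \<phi>.bounded by blast
  have low: "- K\<^sup>2 \<le> J x" for x
  proof -
    have "2 * \<phi> x \<le> 2 * (norm x * K)"
      using K[of x] by simp
    moreover have "0 \<le> (norm x - K)\<^sup>2" by simp
    ultimately show ?thesis
      by (simp add: J_def power2_diff)
  qed
  then have bdd: "bdd_below (range J)"
    by (intro bdd_belowI[of _ "- K\<^sup>2"]) auto
  define m where "m = (INF x. J x)"
  have m_le: "m \<le> J x" for x
    unfolding m_def by (rule cINF_lower[OF bdd]) simp
  have "\<exists>x. J x < m + inverse (real (Suc n))" for n
    using cINF_less_iff[of UNIV J "m + inverse (real (Suc n))"] bdd by (simp add: m_def)
  then obtain X where X: "\<And>n. J (X n) < m + inverse (real (Suc n))"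
    by metis
  \<comment> \<open>By the parallelogram law the left side is \<open>2 * J x + 2 * J y\<close> minus
    four times \<open>J\<close> at the midpoint, and \<open>m\<close> bounds the latter from
    below.\<close>
  have mid: "(norm (x - y))\<^sup>2 \<le> 2 * (J x - m) + 2 * (J y - m)" for x y
  proof -
    have "J ((1/2) *\<^sub>R (x + y)) = (norm (x + y))\<^sup>2 / 4 - \<phi> x - \<phi> y"
      by (simp add: J_def \<phi>.scaleR \<phi>.add power_divide add_divide_distrib)
    then show ?thesis
      using m_le[of "(1/2) *\<^sub>R (x + y)"] parallelogram_law[of x y] by (simp add: J_def)
  qed
  have "Cauchy X"
  proof (rule metric_CauchyI)
    fix e :: real assume "e > 0"
    then obtain N where N: "inverse (real (Suc N)) < e\<^sup>2 / 4"
      using reals_Archimedean[of "e\<^sup>2 / 4"] by auto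
    have close: "J (X p) - m < e\<^sup>2 / 4" if "N \<le> p" for p
    proof -
      have "J (X p) - m < inverse (real (Suc p))"
        using X[of p] by simp
      also have "\<dots> \<le> inverse (real (Suc N))"
        using that by simp
      finally show ?thesis using N by simp
    qed
    show "\<exists>M. \<forall>p\<ge>M. \<forall>n\<ge>M. dist (X p) (X n) < e"
    proof (intro exI allI impI)
      fix p n assume "N \<le> p" "N \<le> n"
      then have "(norm (X p - X n))\<^sup>2 < e\<^sup>2"
        using mid[of "X p" "X n"] close[of p] close[of n] by simp
      then show "dist (X p) (X n) < e"
        using \<open>e > 0\<close> by (simp add: dist_norm power_less_imp_less_base)
    qed
  qed
  then obtain a where a: "X \<longlonglongrightarrow> a"
    using Cauchy_convergent convergent_def by blast
  have "(\<lambda>n. J (X n)) \<longlonglongrightarrow> J a"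
    unfolding J_def by (intro tendsto_intros \<phi>.tendsto a)
  moreover have "(\<lambda>n. m + inverse (real (Suc n))) \<longlonglongrightarrow> m + 0"
    by (intro tendsto_intros LIMSEQ_inverse_real_of_nat)
  ultimately have "J a \<le> m + 0"
    by (rule LIMSEQ_le) (use X less_imp_le in blast)
  have "\<phi> x = inner x a" for x
  proof (cases "x = 0")
    case False
    define c where "c = inner x a - \<phi> x"
    \<comment> \<open>The minimum point of the quadratic polynomial
      \<open>J (a + t *\<^sub>R x)\<close> in \<open>t\<close>; unless \<open>c = 0\<close>, its
      value there lies below \<open>J a\<close>.\<close>
    define t where "t = - c / (norm x)\<^sup>2"
    have "J a \<le> J (a + t *\<^sub>R x)"
      using \<open>J a \<le> m + 0\<close> m_le[of "a + t *\<^sub>R x"] by simp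
    also have "J (a + t *\<^sub>R x) = J a + t\<^sup>2 * (norm x)\<^sup>2 + 2 * t * c"
      unfolding J_def power2_norm_eq_inner c_def
      by (simp add: \<phi>.add \<phi>.scaleR inner_add inner_commute algebra_simps power2_eq_square)
    also have "t\<^sup>2 * (norm x)\<^sup>2 + 2 * t * c = - c\<^sup>2 / (norm x)\<^sup>2"
      using False by (simp add: t_def power2_eq_square field_simps)
    then have "J a + t\<^sup>2 * (norm x)\<^sup>2 + 2 * t * c = J a - c\<^sup>2 / (norm x)\<^sup>2"
      by linarith
    finally have "c\<^sup>2 / (norm x)\<^sup>2 \<le> 0" by simp
    then have "c = 0"
      using False by (simp add: divide_le_0_iff)
    then show ?thesis by (simp add: c_def)
  qed (simp add: \<phi>.zero)
  then show ?thesis using that by blast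
qed

text \<open>A complex-linear functional is determined by its real part: multiplying the argument by
  \<open>\<i>\<close> exchanges real and imaginary parts up to sign.\<close>

lemma riesz_complex:
  fixes \<phi> :: "'a::chilbert_space \<Rightarrow> complex"
  assumes "bounded_linear \<phi>" and sc: "\<And>c x. \<phi> (c *\<^sub>C x) = c * \<phi> x"
  obtains a where "\<And>x. \<phi> x = cinner x a"
proof -
  have "bounded_linear (\<lambda>x. Re (\<phi> x))"
    using assms(1) bounded_linear_Re bounded_linear_compose by blast
  then obtain a where a: "\<And>x. Re (\<phi> x) = inner x a"
    by (rule riesz_real) blast
  have "\<phi> x = cinner x a" for x
  proof (rule complex_eqI)
    show "Re (\<phi> x) = Re (cinner x a)" by (simp add: a Re_cinner)
    have "Re (\<phi> (\<i> *\<^sub>C x)) = Re (cinner (\<i> *\<^sub>C x) a)"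
      by (simp add: a Re_cinner)
    then show "Im (\<phi> x) = Im (cinner x a)"
      by (simp add: sc cinner_scaleC_left)
  qed
  then show ?thesis using that by blast
qed

lemma adjoint_exists:
  fixes S :: "'a::chilbert_space \<Rightarrow> 'b::complex_inner"
  assumes "bounded_clinear S"
  obtains R where "bounded_clinear R" "\<And>x y. cinner (S x) y = cinner x (R y)"
proof -
  have "\<exists>r. \<forall>x. cinner (S x) y = cinner x r" for y
    by (rule riesz_complex[of "\<lambda>x. cinner (S x) y"])
      (auto simp: bounded_clinear_scaleC[OF assms] cinner_scaleC_left
        intro: bounded_linear_compose[OF bounded_linear_cinner_left]
          bounded_clinear_bounded_linear[OF assms])
  then obtain R where R: "\<And>x y. cinner (S x) y = cinner x (R y)"
    by metis
  obtain K where K: "K > 0" "\<And>x. norm (S x) \<le> K * norm x"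
    using bounded_clinear_bound[OF assms] by blast
  have "bounded_clinear R"
  proof (rule bounded_clinearI)
    show "R (x + y) = R x + R y" for x y
      by (rule cinner_eq_rightI) (simp add: R[symmetric] cinner_add_right)
    show "R (c *\<^sub>C x) = c *\<^sub>C R x" for c x
      by (rule cinner_eq_rightI) (simp add: R[symmetric] cinner_scaleC_right)
    show "norm (R x) \<le> K * norm x" for x
    proof (cases "R x = 0")
      case False
      have "complex_of_real ((norm (R x))\<^sup>2) = cinner (S (R x)) x"
        by (simp only: cinner_self[symmetric] R)
      then have "(norm (R x))\<^sup>2 \<le> norm (S (R x)) * norm x"
        using cmod_cinner_le[of "S (R x)" x] by (metis norm_of_real abs_of_nonneg zero_le_power2)
      also have "\<dots> \<le> K * norm (R x) * norm x"
        by (intro mult_right_mono K) simp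
      finally have "norm (R x) * norm (R x) \<le> norm (R x) * (K * norm x)"
        by (simp add: power2_eq_square mult_ac)
      then show ?thesis
        using False by simp
    qed (use K in simp)
  qed
  then show ?thesis using R that by blast
qed

lemma bounded_adjoint:
  fixes S :: "'a::chilbert_space \<Rightarrow> 'a"
  assumes "bounded_clinear S"
  shows "cinner (S x) y = cinner x (bounded_adjoint S y)"
proof -
  obtain R where R: "\<And>x y. cinner (S x) y = cinner x (R y)"
    using adjoint_exists[OF assms] by blast
  have "bounded_adjoint S = R"
    unfolding bounded_adjoint_def
  proof (rule the_equality)
    fix R' assume "\<forall>x y. cinner (S x) y = cinner x (R' y)"
    then have "cinner x (R' y) = cinner x (R y)" for x y
      using R by metis
    then show "R' = R"
      by (intro ext cinner_eq_rightI)
  qed (use R in blast)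
  with R show ?thesis by simp
qed

text \<open>Uniform boundedness by Baire's theorem: the closed sets \<open>E n\<close> exhaust the
  space, so one contains a ball, and differences of its points move the bound to a ball around
  0.\<close>

lemma weakly_bounded_imp_bounded:
  fixes F :: "'a::{real_inner,banach} set"
  assumes "\<And>k. \<exists>C. \<forall>w\<in>F. \<bar>inner w k\<bar> \<le> C"
  shows "bounded F"
proof -
  define E where "E n = {k. \<forall>w\<in>F. \<bar>inner w k\<bar> \<le> real n}" for n
  have closed: "closed (E n)" for n
  proof -
    have "E n = (\<Inter>w\<in>F. {k. \<bar>inner w k\<bar> \<le> real n})"
      by (auto simp: E_def)
    moreover have "closed {k. \<bar>inner w k\<bar> \<le> real n}" for w
      by (intro closed_Collect_le continuous_intros)
    ultimately show ?thesis by auto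
  qed
  have cover: "(\<Union>n. E n) = UNIV"
  proof -
    have "\<exists>n. k \<in> E n" for k
    proof -
      obtain C where C: "\<forall>w\<in>F. \<bar>inner w k\<bar> \<le> C" using assms by blast
      obtain n where "C \<le> real n" using real_arch_simple by blast
      then have "k \<in> E n" using C by (force simp: E_def)
      then show ?thesis by blast
    qed
    then show ?thesis by auto
  qed
  have "\<exists>n. interior (E n) \<noteq> {}"
  proof (rule ccontr)
    assume "\<nexists>n. interior (E n) \<noteq> {}"
    then have "Met_TC.mtopology interior_of (\<Union>(range E)) = ({} :: 'a set)"
      by (intro Met_TC.metric_Baire_category_alt)
        (auto simp: closed complete_UNIV)
    then show False
      using cover by simp
  qed
  then obtain n k0 where "k0 \<in> interior (E n)" by blast
  then obtain r where r: "r > 0" "ball k0 r \<subseteq> E n"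
    by (meson mem_interior)
  have "norm w \<le> 4 * real n / r" if w: "w \<in> F" for w
  proof (cases "w = 0")
    case False
    \<comment> \<open>\<open>w\<close> is rescaled to length \<open>r / 2\<close>, so that
      \<open>k0 + k\<close> stays in the ball; \<open>r * norm w / 2 \<le> 2 * real n\<close> is the
      source of \<open>4 * real n / r\<close>.\<close>
    define k where "k = (r / (2 * norm w)) *\<^sub>R w"
    have "norm k < r"
      using False r by (simp add: k_def)
    then have "k0 + k \<in> E n" "k0 \<in> E n"
      using r by (auto simp: subset_iff dist_norm)
    then have "\<bar>inner w (k0 + k)\<bar> \<le> real n" "\<bar>inner w k0\<bar> \<le> real n"
      using w by (auto simp: E_def)
    then have "inner w k \<le> 2 * real n"
      unfolding inner_add_right by linarith
    also have "inner w k = r * norm w / 2"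
      using False by (simp add: k_def dot_square_norm power2_eq_square)
    finally show ?thesis
      using r by (simp add: field_simps)
  qed (use r in simp)
  then show ?thesis
    by (auto simp: bounded_iff)
qed

text \<open>The constant may depend on \<open>k\<close>; uniform boundedness of the values on the
  unit ball removes this dependence.\<close>

lemma bounded_clinear_of_weakly_bounded:
  fixes W :: "'a::complex_inner \<Rightarrow> 'b::chilbert_space"
  assumes add: "\<And>x y. W (x + y) = W x + W y" and scale: "\<And>c x. W (c *\<^sub>C x) = c *\<^sub>C W x"
    and bound: "\<And>k. \<exists>C. \<forall>x. cmod (cinner (W x) k) \<le> C * norm x"
  shows "bounded_clinear W"
proof -
  have "bounded (W ` cball 0 1)"
  proof (rule weakly_bounded_imp_bounded)
    fix k
    obtain C where C: "\<And>x. cmod (cinner (W x) k) \<le> C * norm x"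
      using bound[of k] by blast
    have "\<bar>inner (W x) k\<bar> \<le> \<bar>C\<bar>" if "x \<in> cball 0 1" for x
    proof -
      have "\<bar>inner (W x) k\<bar> \<le> cmod (cinner (W x) k)"
        by (simp add: Re_cinner[symmetric] abs_Re_le_cmod)
      also have "\<dots> \<le> \<bar>C\<bar> * norm x"
        using C[of x] by (meson abs_ge_self mult_right_mono norm_ge_zero order_trans)
      also have "\<dots> \<le> \<bar>C\<bar> * 1"
        using that by (intro mult_left_mono) auto
      finally show ?thesis by simp
    qed
    then show "\<exists>C. \<forall>w\<in>W ` cball 0 1. \<bar>inner w k\<bar> \<le> C"
      by blast
  qed
  then obtain M where M: "\<And>x. norm x \<le> 1 \<Longrightarrow> norm (W x) \<le> M"
    unfolding bounded_iff by (metis image_eqI mem_cball_0)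
  have "norm (W x) \<le> M * norm x" for x
    by (rule homogeneous_bound) (use scale M in blast)+
  then show ?thesis
    using add scale by (intro bounded_clinearI)
qed

section \<open>Singular value decomposition of a compact operator\<close>

lemma compact_op_bounded_clinear: "compact_op S \<Longrightarrow> bounded_clinear S"
  by (simp add: compact_op_def)

lemma compact_op_subseq:
  assumes S: "compact_op S" and bdd: "\<And>n. norm (X n) \<le> C"
  obtains r z where "strict_mono (r :: nat \<Rightarrow> nat)" "(\<lambda>n. S (X (r n))) \<longlonglongrightarrow> z"
proof -
  let ?K = "closure (S ` range X)"
  have "bounded (range X)"
    unfolding bounded_iff by (rule exI[of _ C]) (use bdd in blast)
  then have "compact ?K"
    using S unfolding compact_op_def by blast
  then have "seq_compact ?K"
    by (rule compact_imp_seq_compact)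
  moreover have "\<forall>n. S (X n) \<in> ?K"
    by (intro allI subsetD[OF closure_subset]) simp
  ultimately obtain z r where "strict_mono r" "((\<lambda>n. S (X n)) \<circ> r) \<longlonglongrightarrow> z"
    by (elim seq_compactE[where f = "\<lambda>n. S (X n)"])
  then show ?thesis
    by (intro that[of r z]) (simp_all add: o_def)
qed

text \<open>No weak compactness is needed: the images of a maximising sequence subconverge to a vector
  of maximal norm, and by the parallelogram law this forces the sequence itself to converge.\<close>

lemma compact_op_attains_norm:
  fixes S :: "'a::chilbert_space \<Rightarrow> 'b::complex_inner"
  assumes S: "compact_op S"
    and V: "closed V" "0 \<in> V" "\<And>x y. x \<in> V \<Longrightarrow> y \<in> V \<Longrightarrow> x + y \<in> V"
      "\<And>c x. x \<in> V \<Longrightarrow> c *\<^sub>C x \<in> V"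
  obtains y where "y \<in> V" "norm y \<le> 1" "\<And>x. x \<in> V \<Longrightarrow> norm (S x) \<le> norm (S y) * norm x"
proof -
  note lin = compact_op_bounded_clinear[OF S]
  obtain K where K: "K > 0" "\<And>x. norm (S x) \<le> K * norm x"
    using bounded_clinear_bound[OF lin] by blast
  let ?U = "V \<inter> cball 0 1"
  define M where "M = (SUP x\<in>?U. norm (S x))"
  have bdd: "bdd_above ((\<lambda>x. norm (S x)) ` ?U)"
  proof (rule bdd_aboveI2)
    fix x assume "x \<in> ?U"
    then have "K * norm x \<le> K * 1"
      using K by (intro mult_left_mono) auto
    then show "norm (S x) \<le> K"
      using K(2)[of x] by simp
  qed
  have upper1: "norm (S x) \<le> M" if "x \<in> ?U" for x
    unfolding M_def by (rule cSUP_upper[OF that bdd])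
  have upper: "norm (S x) \<le> M * norm x" if "x \<in> V" for x
    by (rule homogeneous_bound) (simp add: bounded_clinear_scaleC[OF lin],
        intro upper1, simp add: V that)
  have "M \<ge> 0"
    using upper1[of 0] V by (simp add: bounded_clinear_zero[OF lin])
  show ?thesis
  proof (cases "M = 0")
    case True
    show ?thesis
      by (rule that[of 0]) (use V(2) upper True in \<open>simp_all add: bounded_clinear_zero[OF lin]\<close>)
  next
    case False
    with \<open>M \<ge> 0\<close> have "M > 0" by simp
    have "\<exists>x. x \<in> V \<and> norm x \<le> 1 \<and> M - inverse (real (Suc n)) < norm (S x)" for n
    proof -
      have "M - inverse (real (Suc n)) < (SUP x\<in>?U. norm (S x))"
        unfolding M_def[symmetric] by simp
      moreover have "?U \<noteq> {}" using V by force
      ultimately obtain x where "x \<in> ?U" "M - inverse (real (Suc n)) < norm (S x)"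
        using less_cSUP_iff[OF _ bdd] by blast
      then show ?thesis by auto
    qed
    then obtain X where X: "\<And>n. X n \<in> V" "\<And>n. norm (X n) \<le> 1"
        "\<And>n. M - inverse (real (Suc n)) < norm (S (X n))"
      by metis
    obtain r z where r: "strict_mono r" and z: "(\<lambda>n. S (X (r n))) \<longlonglongrightarrow> z"
      by (rule compact_op_subseq[OF S X(2)])
    define Y where "Y n = X (r n)" for n
    have Y: "Y n \<in> V" "norm (Y n) \<le> 1" for n
      by (simp_all add: Y_def X)
    have zY: "(\<lambda>n. S (Y n)) \<longlonglongrightarrow> z"
      using z by (simp add: Y_def)
    have "norm z = M"
    proof (rule LIMSEQ_unique)
      show "(\<lambda>n. norm (S (Y n))) \<longlonglongrightarrow> norm z"
        by (rule tendsto_norm[OF zY])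
      have "(\<lambda>n. M - inverse (real (Suc n))) \<longlonglongrightarrow> M - 0"
        by (intro tendsto_intros LIMSEQ_inverse_real_of_nat)
      then have "(\<lambda>n. M - inverse (real (Suc (r n)))) \<longlonglongrightarrow> M"
        using LIMSEQ_subseq_LIMSEQ[OF _ r] by (fastforce simp: o_def)
      then show "(\<lambda>n. norm (S (Y n))) \<longlonglongrightarrow> M"
      proof (rule tendsto_sandwich[rotated 2])
        show "\<forall>\<^sub>F n in sequentially. M - inverse (real (Suc (r n))) \<le> norm (S (Y n))"
          unfolding Y_def by (intro always_eventually allI less_imp_le X(3))
        show "\<forall>\<^sub>F n in sequentially. norm (S (Y n)) \<le> M"
          by (intro always_eventually allI upper1) (simp add: Y)
      qed simp
    qed
    have "Cauchy Y"
    proof (rule metric_CauchyI)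
      fix e :: real assume "e > 0"
      \<comment> \<open>With this \<open>d\<close>, the estimate
        \<open>2 * M < M * t + 2 * d\<close> reads \<open>2 - t < e\<^sup>2 / 4\<close>; the factor
        4 is spent in \<open>4 - t\<^sup>2 \<le> (2 - t) * 4\<close>.\<close>
      define d where "d = M * e\<^sup>2 / 8"
      have "d > 0" using \<open>M > 0\<close> \<open>e > 0\<close> by (simp add: d_def)
      then obtain N where N: "\<And>n. n \<ge> N \<Longrightarrow> norm (S (Y n) - z) < d"
        using LIMSEQ_D[OF zY] by blast
      show "\<exists>N. \<forall>p\<ge>N. \<forall>q\<ge>N. dist (Y p) (Y q) < e"
      proof (intro exI allI impI)
        fix p q assume pq: "N \<le> p" "N \<le> q"
        define t where "t = norm (Y p + Y q)"
        have "2 * M = norm ((S (Y p) + S (Y q)) - ((S (Y p) - z) + (S (Y q) - z)))"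
          using \<open>norm z = M\<close> by (simp add: scaleR_2[symmetric] algebra_simps)
        also have "\<dots> < norm (S (Y p) + S (Y q)) + 2 * d"
          using norm_triangle_ineq4[of "S (Y p) + S (Y q)" "(S (Y p) - z) + (S (Y q) - z)"]
            norm_triangle_ineq[of "S (Y p) - z" "S (Y q) - z"] N[OF pq(1)] N[OF pq(2)] by linarith
        also have "norm (S (Y p) + S (Y q)) \<le> M * t"
          using upper[of "Y p + Y q"] Y V(3) by (simp add: t_def bounded_clinear_add[OF lin])
        finally have "M * (2 - t) < M * (e\<^sup>2 / 4)"
          by (simp add: d_def algebra_simps)
        then have "2 - t < e\<^sup>2 / 4"
          using \<open>M > 0\<close> by simp
        moreover have "0 \<le> t" "t \<le> 2"
          using norm_triangle_ineq[of "Y p" "Y q"] Y(2)[of p] Y(2)[of q] by (simp_all add: t_def)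
        then have "4 - t\<^sup>2 \<le> (2 - t) * 4"
          using mult_left_mono[of "2 + t" 4 "2 - t"] by (simp add: power2_eq_square algebra_simps)
        ultimately have "4 - t\<^sup>2 < e\<^sup>2" by simp
        moreover have "(norm (Y p))\<^sup>2 \<le> 1" "(norm (Y q))\<^sup>2 \<le> 1"
          using Y by (simp_all add: power_le_one)
        ultimately have "(norm (Y p - Y q))\<^sup>2 < e\<^sup>2"
          using parallelogram_law[of "Y p" "Y q"] unfolding t_def by linarith
        then show "dist (Y p) (Y q) < e"
          using \<open>e > 0\<close> by (simp add: dist_norm power_less_imp_less_base)
      qed
    qed
    then obtain y where y: "Y \<longlonglongrightarrow> y"
      using Cauchy_convergent convergent_def by blast
    show ?thesis
    proof (rule that[of y])
      show "y \<in> V"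
        using closed_sequentially[OF V(1) _ y] Y by blast
      show "norm y \<le> 1"
        using LIMSEQ_le_const2[OF tendsto_norm[OF y]] Y by blast
      have "S y = z"
        using LIMSEQ_unique[OF bounded_clinear_tendsto[OF lin y] zY] .
      then show "norm (S x) \<le> norm (S y) * norm x" if "x \<in> V" for x
        using upper[OF that] \<open>norm z = M\<close> by simp
    qed
  qed
qed

text \<open>The right singular vectors are obtained greedily.  Once the singular values vanish,
  \<open>e n = 0\<close>; the other \<open>e n\<close> are unit vectors.\<close>

locale singular_system =
  fixes S :: "'a::chilbert_space \<Rightarrow> 'a" and e :: "nat \<Rightarrow> 'a"
  assumes compact_S: "compact_op S"
    and orth_less: "i < n \<Longrightarrow> cinner (e n) (e i) = 0"
    and norm_e_le: "norm (e n) \<le> 1"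
    and e_zero: "S (e n) = 0 \<Longrightarrow> e n = 0"
    and maximal: "(\<And>i. i < n \<Longrightarrow> cinner x (e i) = 0) \<Longrightarrow> norm (S x) \<le> norm (S (e n)) * norm x"

text \<open>Each vector is a maximiser on the closed orthogonal complement of its predecessors;
  \<open>P f n\<close> looks at \<open>f\<close> only below \<open>n\<close>, as recursive choice
  demands.\<close>

lemma singular_system_exists:
  assumes S: "compact_op (S :: 'a::chilbert_space \<Rightarrow> 'a)"
  obtains e where "singular_system S e"
proof -
  define V where "V f n = {x. \<forall>i<n. cinner x (f i) = 0}" for f :: "nat \<Rightarrow> 'a" and n :: nat
  define P where "P f n r \<longleftrightarrow> r \<in> V f n \<and> norm r \<le> 1 \<and> (S r = 0 \<longrightarrow> r = 0) \<and>
    (\<forall>x\<in>V f n. norm (S x) \<le> norm (S r) * norm x)" for f n r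
  have "\<exists>f. \<forall>n. P f n (f n)"
  proof (rule dependent_wellorder_choice)
    fix f g :: "nat \<Rightarrow> 'a" and n r
    assume "\<And>i. i < n \<Longrightarrow> f i = g i"
    then have "V f n = V g n"
      unfolding V_def by auto
    then show "P f n r = P g n r"
      by (simp add: P_def)
  next
    fix n and f :: "nat \<Rightarrow> 'a"
    have "V f n = (\<Inter>i\<in>{..<n}. {x. cinner x (f i) = 0})"
      by (auto simp: V_def)
    moreover have "closed {x. cinner x k = 0}" for k :: 'a
      by (intro closed_Collect_eq continuous_intros
          linear_continuous_on[OF bounded_linear_cinner_left])
    ultimately have "closed (V f n)" by auto
    then obtain y where y: "y \<in> V f n" "norm y \<le> 1"
        "\<And>x. x \<in> V f n \<Longrightarrow> norm (S x) \<le> norm (S y) * norm x"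
      by (rule compact_op_attains_norm[OF S])
        (auto simp: V_def cinner_add_left cinner_scaleC_left)
    \<comment> \<open>If the maximiser has \<open>S y = 0\<close>, then \<open>S\<close> vanishes on
      all of \<open>V f n\<close>, so 0 is a maximiser too.\<close>
    have "P f n (if S y = 0 then 0 else y)"
      using y bounded_clinear_zero[OF compact_op_bounded_clinear[OF S]]
      by (auto simp: P_def V_def)
    then show "\<exists>r. P f n r" by blast
  qed
  then obtain e where e: "\<And>n. P e n (e n)" by blast
  have "singular_system S e"
    by unfold_locales (use S e in \<open>simp_all add: P_def V_def\<close>)
  then show ?thesis using that by blast
qed

context singular_system
begin

lemmas lin = compact_op_bounded_clinear[OF compact_S]

text \<open>These will be the singular numbers, numbered from 0: \<open>\<sigma> n\<close> is
  \<open>singular_number S (n + 1)\<close>.\<close>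

definition \<sigma> :: "nat \<Rightarrow> real" where "\<sigma> n = norm (S (e n))"

definition proj :: "nat \<Rightarrow> 'a \<Rightarrow> 'a" where
  "proj n x = (\<Sum>i<n. cinner x (e i) *\<^sub>C e i)"

lemma \<sigma>_nonneg: "0 \<le> \<sigma> n"
  by (simp add: \<sigma>_def)

lemma orth: "i \<noteq> j \<Longrightarrow> cinner (e i) (e j) = 0"
  using orth_less[of i j] orth_less[of j i] cinner_commute[of "e i" "e j"]
  by (cases i j rule: linorder_cases) simp_all

lemma e_eq_0_iff: "e n = 0 \<longleftrightarrow> \<sigma> n = 0"
  using e_zero by (auto simp: \<sigma>_def bounded_clinear_zero[OF lin])

text \<open>Maximality tested on \<open>e n\<close> itself gives
  \<open>\<sigma> n \<le> \<sigma> n * norm (e n)\<close>.\<close>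

lemma norm_e:
  assumes "\<sigma> n \<noteq> 0"
  shows "norm (e n) = 1"
proof -
  have "\<sigma> n \<le> \<sigma> n * norm (e n)"
    unfolding \<sigma>_def by (rule maximal) (rule orth_less)
  then have "1 \<le> norm (e n)"
    using assms \<sigma>_nonneg[of n] by (simp add: mult_le_cancel_left1)
  then show ?thesis
    using norm_e_le[of n] by simp
qed

text \<open>Either \<open>e i\<close> is a unit vector or both sides vanish; thanks to this,
  operators of finite rank need no separate treatment in the expansions.\<close>

lemma cinner_e_e: "cinner x (e i) * cinner (e i) (e i) = cinner x (e i)"
  using norm_e[of i] e_eq_0_iff[of i] by (cases "\<sigma> i = 0") (auto simp: cinner_self)

text \<open>\<open>e n\<close> is also a competitor in the earlier maximisation that produced
  \<open>e m\<close>.\<close>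

lemma \<sigma>_antimono:
  assumes "m \<le> n"
  shows "\<sigma> n \<le> \<sigma> m"
proof -
  have "\<sigma> n \<le> \<sigma> m * norm (e n)"
    unfolding \<sigma>_def by (rule maximal) (use assms in \<open>auto intro: orth\<close>)
  also have "\<dots> \<le> \<sigma> m * 1"
    by (intro mult_left_mono norm_e_le \<sigma>_nonneg)
  finally show ?thesis by simp
qed

lemma decseq_\<sigma>: "decseq \<sigma>"
  by (simp add: decseq_def \<sigma>_antimono)

lemma cinner_sum_e:
  assumes "finite I"
  shows "cinner (\<Sum>i\<in>I. c i *\<^sub>C e i) (e j) = (if j \<in> I then c j * cinner (e j) (e j) else 0)"
proof -
  have "cinner (\<Sum>i\<in>I. c i *\<^sub>C e i) (e j) = (\<Sum>i\<in>I. if i = j then c j * cinner (e j) (e j) else 0)"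
    unfolding cinner_sum_left
    by (intro sum.cong) (auto simp: cinner_scaleC_left orth)
  then show ?thesis
    using assms by simp
qed

lemma cinner_proj: "j < n \<Longrightarrow> cinner (proj n x) (e j) = cinner x (e j)"
  by (simp add: proj_def cinner_sum_e cinner_e_e)

lemma cinner_minus_proj: "j < n \<Longrightarrow> cinner (x - proj n x) (e j) = 0"
  by (simp add: cinner_diff_left cinner_proj)

lemma norm_sum_e:
  assumes "finite I"
  shows "(norm (\<Sum>i\<in>I. c i *\<^sub>C e i))\<^sup>2 = (\<Sum>i\<in>I. (cmod (c i))\<^sup>2 * (norm (e i))\<^sup>2)"
proof -
  have "pairwise (\<lambda>i j. orthogonal (c i *\<^sub>C e i) (c j *\<^sub>C e j)) I"
    by (auto simp: pairwise_def orthogonal_def Re_cinner[symmetric] cinner_scaleC_left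
        cinner_scaleC_right orth)
  then show ?thesis
    by (simp add: norm_sum_Pythagorean[OF assms] norm_scaleC power_mult_distrib)
qed

lemma orthogonal_proj:
  assumes "\<And>i. i < n \<Longrightarrow> cinner y (e i) = 0"
  shows "cinner (\<Sum>i<n. c i *\<^sub>C e i) y = 0"
  using assms by (simp add: cinner_sum_left cinner_scaleC_left cinner_commute[of "e _" y])

lemma norm_proj: "(norm x)\<^sup>2 = (norm (proj n x))\<^sup>2 + (norm (x - proj n x))\<^sup>2"
proof -
  have "orthogonal (proj n x) (x - proj n x)"
    unfolding orthogonal_def Re_cinner[symmetric]
    by (subst proj_def, subst orthogonal_proj) (auto simp: cinner_minus_proj)
  from norm_add_Pythagorean[OF this] show ?thesis by simp
qed

lemma norm_proj_le: "norm (proj n x) \<le> norm x" and norm_minus_proj_le: "norm (x - proj n x) \<le> norm x"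
  using norm_proj[of x n] by (simp_all add: power2_le_imp_le)

text \<open>The residual \<open>x - proj n x\<close> is a competitor in the maximisation for
  \<open>e n\<close>. This is the error bound for approximation by rank \<open>n\<close>.\<close>

lemma norm_S_minus_proj: "norm (S (x - proj n x)) \<le> \<sigma> n * norm x"
proof -
  have "norm (S (x - proj n x)) \<le> \<sigma> n * norm (x - proj n x)"
    unfolding \<sigma>_def by (rule maximal) (rule cinner_minus_proj)
  also have "\<dots> \<le> \<sigma> n * norm x"
    by (intro mult_left_mono norm_minus_proj_le \<sigma>_nonneg)
  finally show ?thesis .
qed

text \<open>First variation: if the inner product were nonzero, moving \<open>e n\<close> slightly
  along \<open>y\<close> would raise the squared norm of the image to first order, but that of the
  vector only to second order.\<close>

lemma S_orthogonal_of_maximal: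
  assumes y: "\<And>i. i \<le> n \<Longrightarrow> cinner y (e i) = 0"
  shows "cinner (S y) (S (e n)) = 0"
proof (rule ccontr)
  define c where "c = cinner (S y) (S (e n))"
  assume "cinner (S y) (S (e n)) \<noteq> 0"
  then have "c \<noteq> 0" by (simp add: c_def)
  then have "S (e n) \<noteq> 0" by (auto simp: c_def)
  then have n1: "norm (e n) = 1"
    by (intro norm_e) (simp add: \<sigma>_def)
  \<comment> \<open>The step length \<open>1 / B\<close> makes the second-order term at most half of
    the first-order gain; the \<open>+ 1\<close> keeps \<open>B\<close> positive.\<close>
  define B where "B = (\<sigma> n)\<^sup>2 * (norm y)\<^sup>2 + 1"
  have "B > 0" by (simp add: B_def add_nonneg_pos)
  define t where "t = 1 / B"
  have "t > 0" using \<open>B > 0\<close> by (simp add: t_def)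
  \<comment> \<open>The factor \<open>cnj c\<close> turns the cross term into the positive number
    \<open>t * (cmod c)\<^sup>2\<close>.\<close>
  define w where "w = (complex_of_real t * cnj c) *\<^sub>C y"
  have nw: "norm w = t * cmod c * norm y"
    using \<open>t > 0\<close> by (simp add: w_def norm_scaleC norm_mult)
  have "cinner w (e i) = 0" if "i \<le> n" for i
    using y[OF that] by (simp add: w_def cinner_scaleC_left)
  then have orthw: "inner w (e n) = 0" and V: "\<And>i. i < n \<Longrightarrow> cinner (e n + w) (e i) = 0"
    by (simp_all add: cinner_add_left orth_less Re_cinner[symmetric])
  have "norm (S (e n + w)) \<le> \<sigma> n * norm (e n + w)"
    unfolding \<sigma>_def by (rule maximal) (rule V)
  then have "(norm (S (e n + w)))\<^sup>2 \<le> (\<sigma> n)\<^sup>2 * (norm (e n + w))\<^sup>2"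
    by (metis norm_ge_zero power_mono power_mult_distrib)
  moreover have "(norm (e n + w))\<^sup>2 = 1 + (norm w)\<^sup>2"
    using n1 orthw by (simp add: power2_norm_eq_inner inner_add inner_commute norm_eq_1)
  moreover have "(norm (S (e n + w)))\<^sup>2 = (\<sigma> n)\<^sup>2 + 2 * inner (S w) (S (e n)) + (norm (S w))\<^sup>2"
    by (simp add: \<sigma>_def power2_norm_eq_inner inner_add inner_commute bounded_clinear_add[OF lin])
  moreover have "inner (S w) (S (e n)) = t * (cmod c)\<^sup>2"
  proof -
    have "cinner (S w) (S (e n)) = complex_of_real t * (c * cnj c)"
      by (simp add: w_def bounded_clinear_scaleC[OF lin] cinner_scaleC_left c_def[symmetric])
    also have "\<dots> = complex_of_real (t * (cmod c)\<^sup>2)"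
      by (simp add: complex_norm_square[symmetric])
    finally show ?thesis
      by (simp add: Re_cinner[symmetric])
  qed
  ultimately have "2 * (t * (cmod c)\<^sup>2) + (norm (S w))\<^sup>2 \<le> (\<sigma> n)\<^sup>2 * (norm w)\<^sup>2"
    by (simp add: distrib_left)
  moreover have "0 \<le> (norm (S w))\<^sup>2" by simp
  ultimately have "2 * (t * (cmod c)\<^sup>2) \<le> (\<sigma> n)\<^sup>2 * (norm w)\<^sup>2"
    by linarith
  also have "\<dots> = t * (cmod c)\<^sup>2 * (t * ((\<sigma> n)\<^sup>2 * (norm y)\<^sup>2))"
    by (simp add: nw power2_eq_square)
  also have "t * ((\<sigma> n)\<^sup>2 * (norm y)\<^sup>2) \<le> 1"
    using \<open>B > 0\<close> by (simp add: t_def B_def field_simps)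
  then have "t * (cmod c)\<^sup>2 * (t * ((\<sigma> n)\<^sup>2 * (norm y)\<^sup>2)) \<le> t * (cmod c)\<^sup>2 * 1"
    using \<open>t > 0\<close> by (intro mult_left_mono) auto
  finally show False
    using \<open>t > 0\<close> \<open>c \<noteq> 0\<close> by simp
qed

lemma S_orth: "i \<noteq> j \<Longrightarrow> cinner (S (e i)) (S (e j)) = 0"
proof (induction i j rule: linorder_wlog)
  case (le i j)
  then have "cinner (S (e j)) (S (e i)) = 0"
    by (intro S_orthogonal_of_maximal orth) auto
  then show ?case
    by (metis cinner_commute complex_cnj_zero)
next
  case (sym i j)
  then show ?case
    by (metis cinner_commute complex_cnj_zero)
qed

text \<open>The weak form of \<open>S^* S e n = (\<sigma> n)\<^sup>2 e n\<close>. The part of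
  \<open>x\<close> orthogonal to \<open>e 0, ..., e n\<close> drops out by maximality, the terms
  below \<open>n\<close> by \<open>S_orth\<close>.\<close>

lemma cinner_S_e: "cinner (S x) (S (e n)) = complex_of_real ((\<sigma> n)\<^sup>2) * cinner x (e n)"
proof -
  have "cinner (S (x - proj (Suc n) x)) (S (e n)) = 0"
    by (intro S_orthogonal_of_maximal cinner_minus_proj) auto
  then have "cinner (S x) (S (e n)) = cinner (S (proj (Suc n) x)) (S (e n))"
    by (simp add: bounded_clinear_diff[OF lin] cinner_diff_left)
  also have "\<dots> = (\<Sum>i<Suc n. cinner x (e i) * cinner (S (e i)) (S (e n)))"
    by (simp add: proj_def bounded_clinear_sum[OF lin] bounded_clinear_scaleC[OF lin]
        cinner_sum_left cinner_scaleC_left bounded_clinear_add[OF lin] cinner_add_left)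
  also have "\<dots> = cinner x (e n) * cinner (S (e n)) (S (e n))"
    by (simp add: S_orth)
  finally show ?thesis
    by (simp add: cinner_self \<sigma>_def)
qed

text \<open>The vectors \<open>S (e n)\<close> are pairwise orthogonal; if their norms stayed above
  some \<open>L > 0\<close>, they would keep distance at least \<open>L\<close>, against
  compactness.\<close>

lemma \<sigma>_tendsto_0: "\<sigma> \<longlonglongrightarrow> 0"
proof -
  obtain L where L: "\<sigma> \<longlonglongrightarrow> L" "\<forall>n. L \<le> \<sigma> n"
    by (rule decseq_convergent[OF decseq_\<sigma> allI[OF \<sigma>_nonneg]])
  have "L \<ge> 0"
    by (rule LIMSEQ_le_const[OF L(1)]) (simp add: \<sigma>_nonneg)
  moreover have "\<not> L > 0"
  proof
    assume "L > 0"
    obtain r z where r: "strict_mono r" and z: "(\<lambda>n. S (e (r n))) \<longlonglongrightarrow> z"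
      by (rule compact_op_subseq[OF compact_S norm_e_le])
    have cauchy: "Cauchy (\<lambda>n. S (e (r n)))"
      by (rule LIMSEQ_imp_Cauchy[OF z])
    obtain N where N: "\<And>p q. p \<ge> N \<Longrightarrow> q \<ge> N \<Longrightarrow> norm (S (e (r p)) - S (e (r q))) < L"
      using metric_CauchyD[OF cauchy \<open>L > 0\<close>] unfolding dist_norm by auto
    let ?i = "r N" and ?j = "r (Suc N)"
    have "?i \<noteq> ?j" using strict_monoD[OF r, of N "Suc N"] by simp
    then have "inner (S (e ?i)) (S (e ?j)) = 0"
      by (simp add: Re_cinner[symmetric] S_orth)
    then have "(norm (S (e ?i) - S (e ?j)))\<^sup>2 = (\<sigma> ?i)\<^sup>2 + (\<sigma> ?j)\<^sup>2"
      by (simp add: \<sigma>_def power2_norm_eq_inner inner_diff inner_commute)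
    moreover have "L\<^sup>2 \<le> (\<sigma> ?i)\<^sup>2"
      using L(2) \<open>L > 0\<close> by (intro power_mono) auto
    ultimately have "L\<^sup>2 \<le> (norm (S (e ?i) - S (e ?j)))\<^sup>2"
      using zero_le_power2[of "\<sigma> ?j"] by linarith
    then have "L \<le> norm (S (e ?i) - S (e ?j))"
      by (rule power2_le_imp_le) simp
    then show False
      using N[of N "Suc N"] by simp
  qed
  ultimately have "L = 0" by simp
  with L(1) show ?thesis by simp
qed

end

section \<open>The modulus and the singular numbers of a compact operator\<close>

text \<open>Polarisation: a sesquilinear form that vanishes on the diagonal is antisymmetric, and
  replacing \<open>y\<close> by \<open>\<i> *\<^sub>C y\<close> makes it symmetric as well.\<close>

lemma positive_op_selfadjoint:
  assumes "positive_op R"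
  shows "cinner (R x) y = cinner x (R y)"
proof -
  have lin: "bounded_clinear R" and real: "\<And>x. cinner (R x) x \<in> \<real>"
    using assms by (auto simp: positive_op_def)
  define B where "B x y = cinner (R x) y - cinner x (R y)" for x y
  have diag: "B x x = 0" for x
    using real[of x] Reals_cnj_iff[of "cinner (R x) x"]
    by (simp add: B_def cinner_commute[of x "R x"])
  have add: "B (x + y) (x + y) = B x x + B x y + B y x + B y y" for x y
    by (simp add: B_def bounded_clinear_add[OF lin] cinner_add_left cinner_add_right)
  have "B x y + B y x = 0"
    using add[of x y] by (simp add: diag)
  moreover have "B x (\<i> *\<^sub>C y) + B (\<i> *\<^sub>C y) x = 0"
    using add[of x "\<i> *\<^sub>C y"] by (simp add: diag)
  then have "\<i> * (B y x - B x y) = 0"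
    by (simp add: B_def bounded_clinear_scaleC[OF lin] cinner_scaleC_left cinner_scaleC_right
        algebra_simps)
  then have "B y x = B x y" by simp
  ultimately have "B x y = 0" by simp
  then show ?thesis by (simp add: B_def)
qed

context singular_system
begin

lemma norm_coefficient_sum:
  assumes "finite I"
  shows "(norm (\<Sum>i\<in>I. (c i * cinner x (e i)) *\<^sub>C e i))\<^sup>2 = (\<Sum>i\<in>I. (cmod (c i))\<^sup>2 * (cmod (cinner x (e i)))\<^sup>2)"
proof -
  have "(cmod (cinner x (e i)))\<^sup>2 * (norm (e i))\<^sup>2 = (cmod (cinner x (e i)))\<^sup>2" for i
    using norm_e[of i] e_eq_0_iff[of i] by (cases "\<sigma> i = 0") auto
  then show ?thesis
    by (simp only: norm_sum_e[OF assms] norm_mult power_mult_distrib mult.assoc)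
qed

lemma norm_proj_eq: "(norm (proj n x))\<^sup>2 = (\<Sum>i<n. (cmod (cinner x (e i)))\<^sup>2)"
  using norm_coefficient_sum[of "{..<n}" "\<lambda>_. 1" x] by (simp add: proj_def)

text \<open>\<open>proj n x\<close> itself need not tend to \<open>x\<close>, since \<open>S\<close>
  may have a kernel. Domination by \<open>S\<close> is assumed so that the lemma also covers a
  competing square root of \<open>S^* S\<close>.\<close>

lemma tendsto_proj:
  assumes R: "bounded_clinear R" and le: "\<And>y. norm (R y) \<le> norm (S y)"
  shows "(\<lambda>n. R (proj n x)) \<longlonglongrightarrow> R x"
proof (rule Lim_null[THEN iffD2], rule Lim_null_comparison[OF always_eventually])
  show "\<forall>n. norm (R (proj n x) - R x) \<le> \<sigma> n * norm x"
  proof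
    fix n
    have "norm (R (proj n x) - R x) = norm (R (x - proj n x))"
      by (simp add: bounded_clinear_diff[OF R] norm_minus_commute)
    also have "\<dots> \<le> \<sigma> n * norm x"
      by (rule order_trans[OF le norm_S_minus_proj])
    finally show "norm (R (proj n x) - R x) \<le> \<sigma> n * norm x" .
  qed
  show "(\<lambda>n. \<sigma> n * norm x) \<longlonglongrightarrow> 0"
    using tendsto_mult[OF \<sigma>_tendsto_0 tendsto_const[of "norm x"]] by simp
qed

lemma cinner_S_proj:
  "cinner (S (proj n x)) (S y) = (\<Sum>i<n. complex_of_real ((\<sigma> i)\<^sup>2) * cinner x (e i) * cinner (e i) y)"
proof -
  have "cinner (S (e i)) (S y) = complex_of_real ((\<sigma> i)\<^sup>2) * cinner (e i) y" for i
    using arg_cong[OF cinner_S_e[of y i], of cnj] by (simp add: cinner_commute[symmetric])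
  then show ?thesis
    by (simp add: proj_def bounded_clinear_sum[OF lin] bounded_clinear_scaleC[OF lin]
        cinner_sum_left cinner_scaleC_left mult_ac)
qed

lemma bounded_clinear_proj: "bounded_clinear (proj n)"
proof (rule bounded_clinearI)
  show "norm (proj n x) \<le> 1 * norm x" for x
    by (simp add: norm_proj_le)
qed (simp_all add: proj_def cinner_add_left scaleC_add_left sum.distrib cinner_scaleC_left
    complex_vector.scale_sum_right scaleC_scaleC)

text \<open>Partial sums of the spectral series of the candidate for the square root of
  \<open>S^* S\<close>.\<close>

definition modulus_part :: "nat \<Rightarrow> 'a \<Rightarrow> 'a" where
  "modulus_part n x = (\<Sum>i<n. (complex_of_real (\<sigma> i) * cinner x (e i)) *\<^sub>C e i)"

definition modulus :: "'a \<Rightarrow> 'a" where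
  "modulus x = lim (\<lambda>n. modulus_part n x)"

text \<open>Pythagoras, the monotonicity of \<open>\<sigma>\<close> and Bessel's inequality. It
  gives the Cauchy property, and with \<open>n = 0\<close> the bound on
  \<open>modulus\<close>.\<close>

lemma norm_modulus_part_diff:
  assumes "n \<le> m"
  shows "norm (modulus_part m x - modulus_part n x) \<le> \<sigma> n * norm x"
proof (rule power2_le_imp_le)
  have "modulus_part m x - modulus_part n x =
      (\<Sum>i\<in>{..<m} - {..<n}. (complex_of_real (\<sigma> i) * cinner x (e i)) *\<^sub>C e i)"
    unfolding modulus_part_def by (rule sum_diff[symmetric]) (use assms in auto)
  then have "(norm (modulus_part m x - modulus_part n x))\<^sup>2 =
      (\<Sum>i\<in>{..<m} - {..<n}. (\<sigma> i)\<^sup>2 * (cmod (cinner x (e i)))\<^sup>2)"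
    by (simp add: norm_coefficient_sum)
  also have "\<dots> \<le> (\<Sum>i\<in>{..<m} - {..<n}. (\<sigma> n)\<^sup>2 * (cmod (cinner x (e i)))\<^sup>2)"
    by (intro sum_mono mult_right_mono power_mono \<sigma>_antimono \<sigma>_nonneg) auto
  also have "\<dots> \<le> (\<Sum>i\<in>{..<m}. (\<sigma> n)\<^sup>2 * (cmod (cinner x (e i)))\<^sup>2)"
    by (intro sum_mono2) auto
  also have "\<dots> = (\<sigma> n)\<^sup>2 * (norm (proj m x))\<^sup>2"
    by (simp add: norm_proj_eq sum_distrib_left)
  also have "\<dots> \<le> (\<sigma> n)\<^sup>2 * (norm x)\<^sup>2"
    by (intro mult_left_mono power_mono norm_proj_le) auto
  finally show "(norm (modulus_part m x - modulus_part n x))\<^sup>2 \<le> (\<sigma> n * norm x)\<^sup>2"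
    by (simp add: power_mult_distrib)
qed (simp add: \<sigma>_nonneg)

lemma modulus_part_tendsto: "(\<lambda>n. modulus_part n x) \<longlonglongrightarrow> modulus x"
proof -
  have "Cauchy (\<lambda>n. modulus_part n x)"
    unfolding Cauchy_altdef2
  proof (intro allI impI)
    fix d :: real assume "d > 0"
    have "(\<lambda>n. \<sigma> n * norm x) \<longlonglongrightarrow> 0"
      using tendsto_mult[OF \<sigma>_tendsto_0 tendsto_const[of "norm x"]] by simp
    then have "eventually (\<lambda>n. \<sigma> n * norm x < d) sequentially"
      using \<open>d > 0\<close> by (rule order_tendstoD(2))
    then obtain N where "\<sigma> N * norm x < d"
      using eventually_happens'[OF sequentially_bot] by blast
    then have "dist (modulus_part n x) (modulus_part N x) < d" if "n \<ge> N" for n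
      using norm_modulus_part_diff[OF that, of x] by (simp add: dist_norm)
    then show "\<exists>N. \<forall>n\<ge>N. dist (modulus_part n x) (modulus_part N x) < d"
      by blast
  qed
  then show ?thesis
    unfolding modulus_def by (simp add: Cauchy_convergent convergent_LIMSEQ_iff[symmetric])
qed

lemma modulus_eqI: "(\<lambda>n. modulus_part n x) \<longlonglongrightarrow> y \<Longrightarrow> modulus x = y"
  using LIMSEQ_unique[OF modulus_part_tendsto] .

lemma modulus_eq_of_eventually:
  assumes "\<And>n. n \<ge> N \<Longrightarrow> modulus_part n x = y"
  shows "modulus x = y"
  using assms by (intro modulus_eqI tendsto_eventually eventually_sequentiallyI[of N])

lemma bounded_clinear_modulus: "bounded_clinear modulus"
proof (rule bounded_clinearI)
  show "modulus (x + y) = modulus x + modulus y" for x y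
  proof (rule modulus_eqI)
    have "modulus_part n (x + y) = modulus_part n x + modulus_part n y" for n
      by (simp add: modulus_part_def cinner_add_left distrib_left scaleC_add_left sum.distrib)
    then show "(\<lambda>n. modulus_part n (x + y)) \<longlonglongrightarrow> modulus x + modulus y"
      by (simp add: tendsto_add modulus_part_tendsto)
  qed
  show "modulus (c *\<^sub>C x) = c *\<^sub>C modulus x" for c x
  proof (rule modulus_eqI)
    have "modulus_part n (c *\<^sub>C x) = c *\<^sub>C modulus_part n x" for n
      by (simp add: modulus_part_def cinner_scaleC_left complex_vector.scale_sum_right
          scaleC_scaleC mult_ac)
    then show "(\<lambda>n. modulus_part n (c *\<^sub>C x)) \<longlonglongrightarrow> c *\<^sub>C modulus x"
      by (simp add: tendsto_scaleC_right modulus_part_tendsto)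
  qed
  show "norm (modulus x) \<le> \<sigma> 0 * norm x" for x
  proof (rule LIMSEQ_le_const2[OF tendsto_norm[OF modulus_part_tendsto]])
    show "\<exists>N. \<forall>n\<ge>N. norm (modulus_part n x) \<le> \<sigma> 0 * norm x"
      using norm_modulus_part_diff[of 0 _ x] by (simp add: modulus_part_def)
  qed
qed

lemma positive_op_modulus: "positive_op modulus"
proof -
  have "cinner (modulus x) x \<in> \<real>\<^sub>\<ge>\<^sub>0" for x
  proof (rule closed_sequentially[OF closed_nonneg_Reals_complex _ tendsto_cinner_left[OF modulus_part_tendsto]])
    fix n
    have "cinner x (e i) * cinner (e i) x = complex_of_real ((cmod (cinner x (e i)))\<^sup>2)" for i
      by (simp only: complex_norm_square cinner_commute[of "e i" x])
    then have "cinner (modulus_part n x) x =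
        complex_of_real (\<Sum>i<n. \<sigma> i * (cmod (cinner x (e i)))\<^sup>2)"
      by (simp add: modulus_part_def cinner_sum_left cinner_scaleC_left mult.assoc)
    then show "cinner (modulus_part n x) x \<in> \<real>\<^sub>\<ge>\<^sub>0"
      by (simp add: sum_nonneg \<sigma>_nonneg del: of_real_sum)
  qed
  then show ?thesis
    unfolding positive_op_def using bounded_clinear_modulus
    by (auto simp: complex_nonneg_Reals_iff complex_is_Real_iff)
qed

lemma cinner_modulus_e: "cinner (modulus x) (e n) = complex_of_real (\<sigma> n) * cinner x (e n)"
proof (rule LIMSEQ_unique[OF tendsto_cinner_left[OF modulus_part_tendsto]])
  have "cinner (modulus_part k x) (e n) = complex_of_real (\<sigma> n) * cinner x (e n)" if "k \<ge> Suc n" for k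
    using that by (simp add: modulus_part_def cinner_sum_e mult.assoc cinner_e_e)
  then show "(\<lambda>k. cinner (modulus_part k x) (e n)) \<longlonglongrightarrow> complex_of_real (\<sigma> n) * cinner x (e n)"
    by (intro tendsto_eventually eventually_sequentiallyI[of "Suc n"])
qed

lemma modulus_e: "modulus (e n) = complex_of_real (\<sigma> n) *\<^sub>C e n"
proof (rule modulus_eq_of_eventually)
  fix k assume "k \<ge> Suc n"
  have "modulus_part k (e n) =
      (\<Sum>i<k. if i = n then (complex_of_real (\<sigma> n) * cinner (e n) (e n)) *\<^sub>C e n else 0)"
    unfolding modulus_part_def by (intro sum.cong) (auto simp: orth)
  also have "\<dots> = (complex_of_real (\<sigma> n) * cinner (e n) (e n)) *\<^sub>C e n"
    using \<open>k \<ge> Suc n\<close> by simp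
  also have "\<dots> = complex_of_real (\<sigma> n) *\<^sub>C e n"
    using norm_e[of n] by (cases "\<sigma> n = 0") (simp_all add: cinner_self)
  finally show "modulus_part k (e n) = complex_of_real (\<sigma> n) *\<^sub>C e n" .
qed

lemma modulus_part_proj:
  assumes R: "bounded_clinear R" and e: "\<And>n. R (e n) = complex_of_real (\<sigma> n) *\<^sub>C e n"
  shows "R (proj n x) = modulus_part n x"
  by (simp add: proj_def modulus_part_def bounded_clinear_sum[OF R] bounded_clinear_scaleC[OF R]
      e scaleC_scaleC mult.commute)

lemma cinner_adjoint_S: "cinner (bounded_adjoint S (S x)) y = cinner (S x) (S y)"
  using bounded_adjoint[OF lin, of y "S x"] by (metis cinner_commute)

text \<open>Compared weakly along truncations: applying \<open>modulus\<close> to a partial sum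
  squares its weights, which matches the expansion of \<open>S (proj n x)\<close> against
  \<open>S y\<close>.\<close>

lemma modulus_modulus: "modulus \<circ> modulus = bounded_adjoint S \<circ> S"
proof (rule ext, rule cinner_eqI)
  fix x y
  have eq: "cinner (modulus (modulus_part n x)) y = cinner (S (proj n x)) (S y)" for n
    unfolding cinner_S_proj
    by (simp add: modulus_part_def bounded_clinear_sum[OF bounded_clinear_modulus]
        bounded_clinear_scaleC[OF bounded_clinear_modulus] modulus_e cinner_sum_left
        cinner_scaleC_left power2_eq_square mult_ac)
  have "(\<lambda>n. cinner (modulus (modulus_part n x)) y) \<longlonglongrightarrow> cinner (modulus (modulus x)) y"
    by (intro tendsto_cinner_left bounded_clinear_tendsto[OF bounded_clinear_modulus]
        modulus_part_tendsto)
  moreover have "(\<lambda>n. cinner (modulus (modulus_part n x)) y) \<longlonglongrightarrow> cinner (S x) (S y)"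
    unfolding eq by (intro tendsto_cinner_left tendsto_proj lin order_refl)
  ultimately have "cinner (modulus (modulus x)) y = cinner (S x) (S y)"
    by (rule LIMSEQ_unique)
  then show "cinner ((modulus \<circ> modulus) x) y = cinner ((bounded_adjoint S \<circ> S) x) y"
    by (simp add: cinner_adjoint_S)
qed

text \<open>A positive square root of \<open>S\<^sup>* S\<close> acts on \<open>e n\<close> as \<open>\<sigma> n\<close>, because \<open>R + \<sigma> n\<close> is injective.\<close>

lemma abs_op_eq_modulus: "abs_op S = modulus"
  unfolding abs_op_def
proof (rule the_equality)
  show "positive_op modulus \<and> modulus \<circ> modulus = bounded_adjoint S \<circ> S"
    using positive_op_modulus modulus_modulus by blast
next
  fix R assume R: "positive_op R \<and> R \<circ> R = bounded_adjoint S \<circ> S"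
  then have linR: "bounded_clinear R" and pos: "\<And>x. 0 \<le> Re (cinner (R x) x)"
    by (auto simp: positive_op_def)
  have RR: "R (R x) = bounded_adjoint S (S x)" for x
    using R by (metis comp_apply)
  have e: "R (e n) = complex_of_real (\<sigma> n) *\<^sub>C e n" for n
  proof (cases "\<sigma> n = 0")
    case True
    then show ?thesis
      using e_eq_0_iff[of n] by (simp add: bounded_clinear_zero[OF linR])
  next
    case False
    \<comment> \<open>\<open>R + \<sigma> n\<close> sends \<open>w\<close> to
      \<open>R (R (e n)) - (\<sigma> n)\<^sup>2 *\<^sub>C e n\<close>, which is 0; positivity of
      \<open>R\<close> then leaves only \<open>w = 0\<close>.\<close>
    define w where "w = R (e n) - complex_of_real (\<sigma> n) *\<^sub>C e n"
    have "R (R (e n)) = complex_of_real ((\<sigma> n)\<^sup>2) *\<^sub>C e n"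
      by (rule cinner_eq_rightI) (simp add: RR bounded_adjoint[OF lin, symmetric] cinner_S_e
          cinner_scaleC_right)
    then have "R w = complex_of_real (- \<sigma> n) *\<^sub>C w"
      by (simp add: w_def bounded_clinear_diff[OF linR] bounded_clinear_scaleC[OF linR]
          complex_vector.scale_right_diff_distrib scaleC_scaleC power2_eq_square
          complex_vector.scale_minus_left)
    then have "cinner (R w) w = complex_of_real (- \<sigma> n * (norm w)\<^sup>2)"
      by (simp add: cinner_scaleC_left cinner_minus_left cinner_self)
    then have "\<sigma> n * (norm w)\<^sup>2 \<le> 0"
      using pos[of w] by simp
    then have "w = 0"
      using False \<sigma>_nonneg[of n] by (simp add: mult_le_0_iff)
    then show ?thesis by (simp add: w_def)
  qed
  \<comment> \<open>Equal norms make \<open>tendsto_proj\<close> applicable to \<open>R\<close>,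
    which is therefore determined by its values on the \<open>e n\<close>.\<close>
  have normR: "norm (R y) = norm (S y)" for y
  proof -
    have "cinner (R y) (R y) = cinner y (bounded_adjoint S (S y))"
      using positive_op_selfadjoint[of R y "R y"] R by (simp add: RR)
    also have "\<dots> = cinner (S y) (S y)"
      by (simp add: bounded_adjoint[OF lin])
    finally have "(norm (R y))\<^sup>2 = (norm (S y))\<^sup>2"
      unfolding cinner_self of_real_eq_iff .
    then show ?thesis by simp
  qed
  have "R x = modulus x" for x
  proof (rule LIMSEQ_unique)
    show "(\<lambda>n. R (proj n x)) \<longlonglongrightarrow> R x"
      by (rule tendsto_proj[OF linR]) (simp add: normR)
    show "(\<lambda>n. R (proj n x)) \<longlonglongrightarrow> modulus x"
      unfolding modulus_part_proj[OF linR e] by (rule modulus_part_tendsto)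
  qed
  then show "R = modulus" by blast
qed

lemma finite_level: "\<mu> > 0 \<Longrightarrow> finite {n. \<mu> \<le> \<sigma> n}"
proof -
  assume "\<mu> > 0"
  then have "eventually (\<lambda>n. \<sigma> n < \<mu>) sequentially"
    using \<sigma>_tendsto_0 order_tendstoD(2) by blast
  then obtain N where N: "\<And>n. n \<ge> N \<Longrightarrow> \<sigma> n < \<mu>"
    by (auto simp: eventually_sequentially)
  then have "{n. \<mu> \<le> \<sigma> n} \<subseteq> {..<N}"
    by (auto simp: not_less[symmetric])
  then show ?thesis
    using finite_subset by blast
qed

lemma independent_e:
  assumes "finite I" "\<And>i. i \<in> I \<Longrightarrow> \<sigma> i \<noteq> 0"
  shows "inj_on e I" "complex_vector.independent (e ` I)"
proof -
  have ee: "cinner (e i) (e i) = 1" if "i \<in> I" for i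
    using norm_e assms(2)[OF that] by (simp add: cinner_self)
  show inj: "inj_on e I"
    using ee orth by (intro inj_onI) (metis zero_neq_one)
  show "complex_vector.independent (e ` I)"
  proof
    assume "complex_vector.dependent (e ` I)"
    then obtain u j where u: "(\<Sum>v\<in>e ` I. u v *\<^sub>C v) = 0" and j: "j \<in> I" "u (e j) \<noteq> 0"
      using assms(1) by (auto simp: complex_vector.dependent_finite)
    have "(\<Sum>i\<in>I. u (e i) *\<^sub>C e i) = 0"
      using u by (simp add: sum.reindex[OF inj])
    then have "u (e j) * cinner (e j) (e j) = 0"
      using cinner_sum_e[OF assms(1), of "\<lambda>i. u (e i)" j] j by simp
    then show False
      using j ee by simp
  qed
qed

text \<open>An eigenvector for \<open>\<mu>\<close> is orthogonal to every \<open>e n\<close> with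
  \<open>\<sigma> n \<noteq> \<mu>\<close>, so its series is a finite sum; dividing by
  \<open>\<mu>\<close> recovers the vector itself.\<close>

lemma eigenspace_modulus:
  assumes "\<mu> > 0"
  shows "eigenspace modulus (complex_of_real \<mu>) = complex_vector.span (e ` {n. \<sigma> n = \<mu>})"
    (is "?E = complex_vector.span (e ` ?I)")
proof
  have fin: "finite ?I"
    by (rule finite_subset[OF _ finite_level[OF assms]]) auto
  show "complex_vector.span (e ` ?I) \<subseteq> ?E"
  proof (rule complex_vector.span_minimal)
    show "e ` ?I \<subseteq> ?E"
      by (auto simp: eigenspace_def modulus_e)
    show "complex_vector.subspace ?E"
      unfolding complex_vector.subspace_def eigenspace_def
      by (simp add: bounded_clinear_zero[OF bounded_clinear_modulus]
          bounded_clinear_add[OF bounded_clinear_modulus]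
          bounded_clinear_scaleC[OF bounded_clinear_modulus] scaleC_add_right scaleC_scaleC mult.commute)
  qed
  show "?E \<subseteq> complex_vector.span (e ` ?I)"
  proof
    fix x assume "x \<in> ?E"
    then have x: "modulus x = complex_of_real \<mu> *\<^sub>C x"
      by (simp add: eigenspace_def)
    have zero: "cinner x (e n) = 0" if "\<sigma> n \<noteq> \<mu>" for n
      using cinner_modulus_e[of x n] that by (simp add: x cinner_scaleC_left)
    obtain N where N: "?I \<subseteq> {..<N}"
      using fin finite_nat_iff_bounded by blast
    define y where "y = (\<Sum>i\<in>?I. (complex_of_real (\<sigma> i) * cinner x (e i)) *\<^sub>C e i)"
    have "modulus x = y"
    proof (rule modulus_eq_of_eventually)
      fix n assume "n \<ge> N"
      then show "modulus_part n x = y"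
        unfolding modulus_part_def y_def
        by (intro sum.mono_neutral_right) (use N zero in auto)
    qed
    moreover have "y \<in> complex_vector.span (e ` ?I)"
      unfolding y_def
      by (intro complex_vector.span_sum complex_vector.span_scale complex_vector.span_base) auto
    moreover have "x = complex_of_real (inverse \<mu>) *\<^sub>C modulus x"
      using assms by (simp add: x scaleC_scaleC)
    ultimately show "x \<in> complex_vector.span (e ` ?I)"
      using complex_vector.span_scale by metis
  qed
qed

lemma eigenvalue_list_\<sigma>: "eigenvalue_list (abs_op S) \<sigma>"
  unfolding eigenvalue_list_def abs_op_eq_modulus
proof (intro conjI allI impI decseq_\<sigma> \<sigma>_nonneg)
  fix \<mu> :: real assume \<mu>: "\<mu> > 0"
  let ?I = "{n. \<sigma> n = \<mu>}"
  show fin: "finite ?I"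
    by (rule finite_subset[OF _ finite_level[OF \<mu>]]) auto
  have "inj_on e ?I" "complex_vector.independent (e ` ?I)"
    using independent_e[OF fin] \<mu> by auto
  then show "card ?I = complex_vector.dim (eigenspace modulus (complex_of_real \<mu>))"
    by (simp add: eigenspace_modulus[OF \<mu>] complex_vector.dim_eq_card_independent card_image)
qed

end

section \<open>Uniqueness of the list of eigenvalues\<close>

text \<open>If \<open>s n < t n\<close> at the first disagreement, then \<open>s\<close> takes the
  value \<open>t n\<close> only before \<open>n\<close>, where it agrees with \<open>t\<close>; so
  \<open>t\<close> takes it at least once more, against the equal multiplicities.\<close>

lemma eigenvalue_list_le:
  assumes s: "eigenvalue_list R s" and t: "eigenvalue_list R t"
    and eq: "\<And>i. i < n \<Longrightarrow> s i = t i"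
  shows "t n \<le> s n"
proof (rule ccontr)
  assume "\<not> t n \<le> s n"
  then have less: "s n < t n" by simp
  define \<mu> where "\<mu> = t n"
  have "\<mu> > 0"
    using less s by (auto simp: \<mu>_def eigenvalue_list_def intro: le_less_trans)
  then have fin: "finite {i. t i = \<mu>}" and card: "card {i. s i = \<mu>} = card {i. t i = \<mu>}"
    using s t by (auto simp: eigenvalue_list_def)
  have "{i. s i = \<mu>} \<subset> {i. t i = \<mu>}"
  proof
    show "{i. s i = \<mu>} \<subseteq> {i. t i = \<mu>}"
    proof
      fix i assume "i \<in> {i. s i = \<mu>}"
      then have i: "s i = \<mu>" by simp
      have "i < n"
      proof (rule ccontr)
        assume "\<not> i < n"
        then have "s i \<le> s n"
          using s by (auto simp: eigenvalue_list_def decseq_def)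
        then show False using i less by (simp add: \<mu>_def)
      qed
      then show "i \<in> {i. t i = \<mu>}" using i by (simp add: eq)
    qed
    have "n \<in> {i. t i = \<mu>}" "n \<notin> {i. s i = \<mu>}"
      using less by (simp_all add: \<mu>_def)
    then show "{i. s i = \<mu>} \<noteq> {i. t i = \<mu>}"
      by blast
  qed
  then have "card {i. s i = \<mu>} < card {i. t i = \<mu>}"
    by (rule psubset_card_mono[OF fin])
  then show False
    using card by simp
qed

lemma eigenvalue_list_unique:
  assumes "eigenvalue_list R s" "eigenvalue_list R t"
  shows "s = t"
proof
  show "s n = t n" for n
  proof (induction n rule: less_induct)
    case (less n)
    then show ?case
      using eigenvalue_list_le[OF assms, of n] eigenvalue_list_le[OF assms(2,1), of n] by simp
  qed
qed

lemma (in singular_system) singular_number_eq: "singular_number S n = \<sigma> (n - 1)"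
  unfolding singular_number_def
  using the_equality[of "eigenvalue_list (abs_op S)" \<sigma>] eigenvalue_list_\<sigma> eigenvalue_list_unique
  by metis

section \<open>Singular numbers as approximation numbers\<close>

text \<open>A finite spanning set is requested because \<open>dim\<close> is 0 on
  infinite-dimensional ranges; sums and images are then immediate.\<close>

definition rank_le :: "('a \<Rightarrow> 'b::complex_inner) \<Rightarrow> nat \<Rightarrow> bool" where
  "rank_le F n \<longleftrightarrow> (\<exists>V. finite V \<and> card V \<le> n \<and> range F \<subseteq> complex_vector.span V)"

lemma rank_le_plus:
  assumes "rank_le F m" "rank_le G n"
  shows "rank_le (\<lambda>x. F x + G x) (m + n)"
proof -
  obtain V W where V: "finite V" "card V \<le> m" "range F \<subseteq> complex_vector.span V"
    and W: "finite W" "card W \<le> n" "range G \<subseteq> complex_vector.span W"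
    using assms by (auto simp: rank_le_def)
  have "F x + G x \<in> complex_vector.span (V \<union> W)" for x
    using V(3) W(3) complex_vector.span_mono[of V "V \<union> W"] complex_vector.span_mono[of W "V \<union> W"]
    by (intro complex_vector.span_add) auto
  moreover have "card (V \<union> W) \<le> m + n"
    using card_Un_le[of V W] V W by linarith
  ultimately show ?thesis
    unfolding rank_le_def using V(1) W(1) by (intro exI[of _ "V \<union> W"]) auto
qed

lemma rank_le_compose:
  assumes "rank_le F n" "bounded_clinear X"
  shows "rank_le (\<lambda>x. X (F (Y x))) n"
proof -
  obtain V where V: "finite V" "card V \<le> n" "range F \<subseteq> complex_vector.span V"
    using assms by (auto simp: rank_le_def)
  interpret X: Vector_Spaces.linear scaleC scaleC X
    by (rule bounded_clinear_clinear[OF assms(2)])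
  have "range (\<lambda>x. X (F (Y x))) \<subseteq> complex_vector.span (X ` V)"
    using V(3) by (auto simp: X.span_image)
  moreover have "card (X ` V) \<le> n"
    using card_image_le[OF V(1), of X] V(2) by simp
  ultimately show ?thesis
    unfolding rank_le_def using V(1) by (intro exI[of _ "X ` V"]) auto
qed

lemma singular_number_nonneg:
  fixes S :: "'a::chilbert_space \<Rightarrow> 'a"
  assumes "compact_op S"
  shows "0 \<le> singular_number S n"
proof -
  obtain e where "singular_system S e"
    using singular_system_exists[OF assms] .
  then interpret singular_system S e .
  show ?thesis by (simp add: singular_number_eq \<sigma>_nonneg)
qed

text \<open>The witness is \<open>S\<close> after \<open>proj (n - 1)\<close>; the shift reflects
  the numbering from 1.\<close>

lemma singular_number_approximation:
  fixes S :: "'a::chilbert_space \<Rightarrow> 'a"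
  assumes "compact_op S"
  obtains F where "bounded_clinear F" "rank_le F (n - 1)"
    "\<And>x. norm (S x - F x) \<le> singular_number S n * norm x"
proof -
  obtain e where "singular_system S e"
    using singular_system_exists[OF assms] .
  then interpret singular_system S e .
  let ?F = "\<lambda>x. S (proj (n - 1) x)"
  have "S (proj (n - 1) x) \<in> complex_vector.span ((\<lambda>i. S (e i)) ` {..<n - 1})" for x
    unfolding proj_def bounded_clinear_sum[OF lin] bounded_clinear_scaleC[OF lin]
    by (intro complex_vector.span_sum complex_vector.span_scale complex_vector.span_base) auto
  then have "rank_le ?F (n - 1)"
    unfolding rank_le_def
    using card_image_le[of "{..<n - 1}" "\<lambda>i. S (e i)"]
    by (intro exI[of _ "(\<lambda>i. S (e i)) ` {..<n - 1}"]) auto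
  moreover have "norm (S x - ?F x) \<le> singular_number S n * norm x" for x
    using norm_S_minus_proj[of x "n - 1"]
    by (simp add: singular_number_eq bounded_clinear_diff[OF lin])
  ultimately show ?thesis
    using that[of ?F] bounded_clinear_compose[OF lin bounded_clinear_proj] by blast
qed

text \<open>An operator of rank at most \<open>n - 1\<close> annihilates a nonzero vector of the span of the first \<open>n\<close>
  singular vectors.\<close>

lemma singular_number_le:
  fixes S F :: "'a::chilbert_space \<Rightarrow> 'a"
  assumes S: "compact_op S" and F: "bounded_clinear F" "rank_le F (n - 1)"
    and bound: "\<And>x. norm (S x - F x) \<le> c * norm x" and "c \<ge> 0"
  shows "singular_number S n \<le> c"
proof -
  obtain e where "singular_system S e"
    using singular_system_exists[OF S] .
  then interpret singular_system S e .
  define m where "m = n - 1"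
  have "\<sigma> m \<le> c"
  proof (cases "\<sigma> m = 0")
    case False
    define B where "B = e ` {..m}"
    have "\<sigma> m \<le> \<sigma> i" if "i \<le> m" for i
      using that by (rule \<sigma>_antimono)
    then have pos: "\<sigma> i \<noteq> 0" if "i \<in> {..m}" for i
      using False \<sigma>_nonneg[of m] that by (metis atMost_iff order_antisym)
    have indep: "complex_vector.independent B" and card: "card B = Suc m"
      using independent_e[of "{..m}"] pos by (auto simp: B_def card_image)
    interpret F: Vector_Spaces.linear scaleC scaleC F
      by (rule bounded_clinear_clinear[OF F(1)])
    \<comment> \<open>Dimension count: \<open>m + 1\<close> independent vectors are mapped into the
      span of at most \<open>m\<close> vectors.\<close>
    have "\<not> inj_on F (complex_vector.span B)"
    proof
      assume inj: "inj_on F (complex_vector.span B)"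
      obtain V where V: "finite V" "card V \<le> m" "range F \<subseteq> complex_vector.span V"
        using F(2) by (auto simp: rank_le_def m_def)
      have "complex_vector.independent (F ` B)"
        by (rule F.independent_injective_image[OF indep inj])
      then have "card (F ` B) \<le> card V"
        using complex_vector.independent_span_bound[OF V(1)] V(3) by blast
      moreover have "card (F ` B) = Suc m"
        using card_image[OF inj_on_subset[OF inj complex_vector.span_superset]] card by simp
      ultimately show False using V(2) by simp
    qed
    then obtain x y where xy: "x \<in> complex_vector.span B" "y \<in> complex_vector.span B"
        "F x = F y" "x \<noteq> y"
      by (auto simp: inj_on_def)
    define z where "z = x - y"
    have z: "z \<in> complex_vector.span B" "F z = 0" "z \<noteq> 0"
      using xy by (auto simp: z_def bounded_clinear_diff[OF F(1)] intro: complex_vector.span_diff)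
    have "proj (Suc m) (e i) = e i" if "i \<le> m" for i
    proof -
      have "proj (Suc m) (e i) = (\<Sum>j<Suc m. if j = i then cinner (e i) (e i) *\<^sub>C e i else 0)"
        unfolding proj_def by (intro sum.cong) (auto simp: orth)
      also have "\<dots> = e i"
        using that norm_e[OF pos] by (simp add: cinner_self)
      finally show ?thesis .
    qed
    then have "complex_vector.span B \<subseteq> {z. proj (Suc m) z = z}"
      by (intro complex_vector.span_minimal)
        (auto simp: B_def complex_vector.subspace_def bounded_clinear_zero[OF bounded_clinear_proj]
          bounded_clinear_add[OF bounded_clinear_proj] bounded_clinear_scaleC[OF bounded_clinear_proj])
    then have proj_z: "proj (Suc m) z = z"
      using z by auto
    \<comment> \<open>On the span of \<open>e 0, ..., e m\<close> the operator \<open>S\<close>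
      stretches norms by at least \<open>\<sigma> m\<close>, while \<open>F z = 0\<close> leaves
      only \<open>c * norm z\<close> as an upper bound.\<close>
    have "complex_of_real ((norm (S z))\<^sup>2) = cinner (S (proj (Suc m) z)) (S z)"
      by (simp only: proj_z cinner_self)
    also have "\<dots> = complex_of_real (\<Sum>i<Suc m. (\<sigma> i)\<^sup>2 * (cmod (cinner z (e i)))\<^sup>2)"
      unfolding cinner_S_proj of_real_sum
      by (intro sum.cong refl)
        (simp only: of_real_mult complex_norm_square mult.assoc cinner_commute[of "e _" z])
    finally have "(norm (S z))\<^sup>2 = (\<Sum>i<Suc m. (\<sigma> i)\<^sup>2 * (cmod (cinner z (e i)))\<^sup>2)"
      unfolding of_real_eq_iff .
    also have "\<dots> \<ge> (\<Sum>i<Suc m. (\<sigma> m)\<^sup>2 * (cmod (cinner z (e i)))\<^sup>2)"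
      by (intro sum_mono mult_right_mono power_mono \<sigma>_antimono \<sigma>_nonneg) auto
    also have "(\<Sum>i<Suc m. (\<sigma> m)\<^sup>2 * (cmod (cinner z (e i)))\<^sup>2) = (\<sigma> m * norm z)\<^sup>2"
      using norm_proj_eq[of "Suc m" z]
      by (simp only: proj_z sum_distrib_left[symmetric] power_mult_distrib)
    finally have "\<sigma> m * norm z \<le> norm (S z)"
      by (rule power2_le_imp_le) simp
    also have "\<dots> \<le> c * norm z"
      using bound[of z] z by simp
    finally show ?thesis
      using z by simp
  qed (use \<open>c \<ge> 0\<close> in simp)
  then show ?thesis
    by (simp add: singular_number_eq m_def)
qed

section \<open>Compactness and singular numbers of sums and products\<close>

lemma compact_closure_subset:
  fixes A :: "'a::metric_space set"
  assumes "A \<subseteq> C" "compact C"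
  shows "compact (closure A)"
proof -
  have "closure A \<subseteq> C"
    using assms by (simp add: closure_minimal compact_imp_closed)
  then have "C \<inter> closure A = closure A" by blast
  then show ?thesis
    using compact_Int_closed[OF assms(2) closed_closure[of A]] by simp
qed

lemma compact_op_plus:
  assumes "compact_op S" "compact_op T"
  shows "compact_op (\<lambda>x. S x + T x)"
  unfolding compact_op_def
proof (intro conjI allI impI)
  show "bounded_clinear (\<lambda>x. S x + T x)"
    using assms by (intro bounded_clinear_plus compact_op_bounded_clinear)
  fix U :: "'a set" assume "bounded U"
  then have "compact {x + y |x y. x \<in> closure (S ` U) \<and> y \<in> closure (T ` U)}"
    using assms by (intro compact_sums) (auto simp: compact_op_def)
  then show "compact (closure ((\<lambda>x. S x + T x) ` U))"
  proof (rule compact_closure_subset[rotated], intro image_subsetI CollectI exI conjI)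
    fix x assume "x \<in> U"
    then show "S x \<in> closure (S ` U)" "T x \<in> closure (T ` U)"
      by (auto intro: subsetD[OF closure_subset])
  qed (rule refl)
qed

lemma compact_op_compose:
  fixes X :: "'b::complex_inner \<Rightarrow> 'c::complex_inner" and Y :: "'d::complex_inner \<Rightarrow> 'a::complex_inner"
  assumes K: "compact_op K" and X: "bounded_clinear X" and Y: "bounded_clinear Y"
  shows "compact_op (\<lambda>x. X (K (Y x)))"
  unfolding compact_op_def
proof (intro conjI allI impI)
  show "bounded_clinear (\<lambda>x. X (K (Y x)))"
    by (rule bounded_clinear_compose[OF X bounded_clinear_compose[OF compact_op_bounded_clinear[OF K] Y]])
  fix U :: "'d set" assume "bounded U"
  then have "bounded (Y ` U)"
    by (rule bounded_linear_image[OF _ bounded_clinear_bounded_linear[OF Y]])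
  then have "compact (closure (K ` Y ` U))"
    using K by (simp add: compact_op_def)
  then have "compact (X ` closure (K ` Y ` U))"
    by (rule compact_continuous_image[OF linear_continuous_on[OF bounded_clinear_bounded_linear[OF X]]])
  then show "compact (closure ((\<lambda>x. X (K (Y x))) ` U))"
    by (rule compact_closure_subset[rotated])
      (intro image_subsetI imageI subsetD[OF closure_subset])
qed

lemma singular_number_plus_le:
  fixes S T :: "'a::chilbert_space \<Rightarrow> 'a"
  assumes S: "compact_op S" and T: "compact_op T" and mn: "1 \<le> m" "1 \<le> n"
  shows "singular_number (\<lambda>x. S x + T x) (m + n - 1) \<le> singular_number S m + singular_number T n"
proof -
  obtain F where F: "bounded_clinear F" "rank_le F (m - 1)"
      "\<And>x. norm (S x - F x) \<le> singular_number S m * norm x"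
    using singular_number_approximation[OF S] by blast
  obtain G where G: "bounded_clinear G" "rank_le G (n - 1)"
      "\<And>x. norm (T x - G x) \<le> singular_number T n * norm x"
    using singular_number_approximation[OF T] by blast
  show ?thesis
  proof (rule singular_number_le[OF compact_op_plus[OF S T] bounded_clinear_plus[OF F(1) G(1)]])
    \<comment> \<open>The ranks \<open>m - 1\<close> and \<open>n - 1\<close> add up to
      \<open>(m + n - 1) - 1\<close>; with truncated subtraction this rests on \<open>m\<close> and
      \<open>n\<close> being at least 1.\<close>
    show "rank_le (\<lambda>x. F x + G x) (m + n - 1 - 1)"
      using rank_le_plus[OF F(2) G(2)] mn by (simp add: algebra_simps)
    show "norm (S x + T x - (F x + G x)) \<le> (singular_number S m + singular_number T n) * norm x" for x
    proof -
      have "norm ((S x - F x) + (T x - G x)) \<le> norm (S x - F x) + norm (T x - G x)"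
        by (rule norm_triangle_ineq)
      also have "\<dots> \<le> singular_number S m * norm x + singular_number T n * norm x"
        by (intro add_mono F G)
      finally show ?thesis by (simp add: algebra_simps)
    qed
    show "0 \<le> singular_number S m + singular_number T n"
      using S T by (simp add: singular_number_nonneg)
  qed
qed

text \<open>If \<open>F\<close> approximates \<open>K\<close>, then \<open>X F Y\<close>
  approximates \<open>X K Y\<close> with no larger rank. This carries estimates from the boundary
  space over to the original space.\<close>

lemma singular_number_compose_le:
  fixes K :: "'k::chilbert_space \<Rightarrow> 'k" and X :: "'k \<Rightarrow> 'h::chilbert_space"
  assumes K: "compact_op K" and X: "bounded_clinear X" and Y: "bounded_clinear Y"
    and normX: "\<And>k. norm (X k) \<le> a * norm k" and normY: "\<And>h. norm (Y h) \<le> b * norm h"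
    and "0 \<le> a" "0 \<le> b"
  shows "singular_number (\<lambda>h. X (K (Y h))) n \<le> a * b * singular_number K n"
proof -
  obtain F where F: "bounded_clinear F" "rank_le F (n - 1)"
      "\<And>x. norm (K x - F x) \<le> singular_number K n * norm x"
    using singular_number_approximation[OF K] by blast
  show ?thesis
  proof (rule singular_number_le[OF compact_op_compose[OF K X Y]])
    show "bounded_clinear (\<lambda>h. X (F (Y h)))"
      by (rule bounded_clinear_compose[OF X bounded_clinear_compose[OF F(1) Y]])
    show "rank_le (\<lambda>h. X (F (Y h))) (n - 1)"
      by (rule rank_le_compose[OF F(2) X])
    show "norm (X (K (Y h)) - X (F (Y h))) \<le> a * b * singular_number K n * norm h" for h
    proof -
      have "norm (X (K (Y h)) - X (F (Y h))) \<le> a * norm (K (Y h) - F (Y h))"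
        using normX by (simp add: bounded_clinear_diff[OF X, symmetric])
      also have "\<dots> \<le> a * (singular_number K n * (b * norm h))"
        using singular_number_nonneg[OF K, of n] \<open>0 \<le> a\<close>
        by (intro mult_left_mono order_trans[OF F(3)] normY)
      finally show ?thesis by (simp add: mult_ac)
    qed
    show "0 \<le> a * b * singular_number K n"
      using assms by (simp add: singular_number_nonneg)
  qed
qed

section \<open>Power asymptotics of sequences related by Ky Fan inequalities\<close>

text \<open>Since \<open>c > 0\<close>, \<open>p n\<close> tends to infinity, and
  \<open>n powr \<alpha>\<close> is \<open>(p n / n) powr (- \<alpha>)\<close> times
  \<open>p n powr \<alpha>\<close>.\<close>

lemma tendsto_powr_mult_reindex:
  fixes x :: "nat \<Rightarrow> real" and p :: "nat \<Rightarrow> nat"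
  assumes p: "(\<lambda>n. real (p n) / real n) \<longlonglongrightarrow> c" and "c > 0"
    and x: "(\<lambda>n. real n powr \<alpha> * x n) \<longlonglongrightarrow> L"
  shows "(\<lambda>n. real n powr \<alpha> * x (p n)) \<longlonglongrightarrow> c powr (- \<alpha>) * L"
proof -
  have "filterlim (\<lambda>n. real (p n) / real n * real n) at_top sequentially"
    by (rule filterlim_tendsto_pos_mult_at_top[OF p \<open>c > 0\<close> filterlim_real_sequentially])
  moreover have "eventually (\<lambda>n. real (p n) / real n * real n = real (p n)) sequentially"
    using eventually_gt_at_top[of 0] by eventually_elim simp
  ultimately have "filterlim (\<lambda>n. real (p n)) at_top sequentially"
    by (simp cong: filterlim_cong)
  then have p_top: "filterlim p at_top sequentially"
    using filterlim_sequentially_iff_filterlim_real by blast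
  have "(\<lambda>n. (real (p n) / real n) powr (- \<alpha>) * (real (p n) powr \<alpha> * x (p n)))
      \<longlonglongrightarrow> c powr (- \<alpha>) * L"
    using \<open>c > 0\<close> by (intro tendsto_mult tendsto_powr p tendsto_const filterlim_compose[OF x p_top]) auto
  moreover have "eventually (\<lambda>n. (real (p n) / real n) powr (- \<alpha>) * (real (p n) powr \<alpha> * x (p n)) =
      real n powr \<alpha> * x (p n)) sequentially"
    using eventually_gt_at_top[of 0] filterlim_iff[THEN iffD1, OF p_top, rule_format, OF eventually_gt_at_top[of 0]]
    by eventually_elim (simp add: powr_divide powr_minus_divide)
  ultimately show ?thesis
    by (rule Lim_transform_eventually)
qed

lemma tendsto_nat_floor_div:
  assumes "\<delta> > 0"
  shows "(\<lambda>n. real (nat \<lfloor>\<delta> * real n\<rfloor>) / real n) \<longlonglongrightarrow> \<delta>"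
proof (rule real_tendsto_sandwich)
  show "eventually (\<lambda>n. \<delta> - 1 / real n \<le> real (nat \<lfloor>\<delta> * real n\<rfloor>) / real n) sequentially"
    using eventually_gt_at_top[of 0]
  proof eventually_elim
    case (elim n)
    have "\<delta> * real n - 1 \<le> real (nat \<lfloor>\<delta> * real n\<rfloor>)" by linarith
    then have "(\<delta> * real n - 1) / real n \<le> real (nat \<lfloor>\<delta> * real n\<rfloor>) / real n"
      by (rule divide_right_mono) simp
    then show ?case using elim by (simp add: diff_divide_distrib)
  qed
  show "eventually (\<lambda>n. real (nat \<lfloor>\<delta> * real n\<rfloor>) / real n \<le> \<delta>) sequentially"
    using eventually_gt_at_top[of 0]
  proof eventually_elim
    case (elim n)
    have "0 \<le> \<delta> * real n" using assms by simp
    then have "real (nat \<lfloor>\<delta> * real n\<rfloor>) \<le> \<delta> * real n" by linarith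
    then show ?case using elim by (simp add: field_simps)
  qed
  show "(\<lambda>n. \<delta> - 1 / real n) \<longlonglongrightarrow> \<delta>"
    using tendsto_diff[OF tendsto_const lim_1_over_n, of \<delta>] by simp
qed simp

text \<open>The index \<open>n\<close> is split into a fraction close to \<open>n\<close>, which carries the main term, and about
  \<open>\<delta> n\<close> indices, which suffice to make the perturbation \<open>d\<close> negligible.\<close>

lemma tendsto_powr_mult_perturbation:
  fixes s t d :: "nat \<Rightarrow> real"
  assumes t_le: "\<And>m n. 1 \<le> m \<Longrightarrow> 1 \<le> n \<Longrightarrow> t (m + n - 1) \<le> s m + d n"
    and s_le: "\<And>m n. 1 \<le> m \<Longrightarrow> 1 \<le> n \<Longrightarrow> s (m + n - 1) \<le> t m + d n"
    and s: "(\<lambda>n. real n powr \<alpha> * s n) \<longlonglongrightarrow> a"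
    and d: "(\<lambda>n. real n powr \<alpha> * d n) \<longlonglongrightarrow> 0"
  shows "(\<lambda>n. real n powr \<alpha> * t n) \<longlonglongrightarrow> a"
proof (rule order_tendstoI)
  \<comment> \<open>The \<open>+ 1\<close> keeps the index positive and cancels the
    \<open>- 1\<close> in \<open>t_le\<close> and \<open>s_le\<close>.\<close>
  let ?v = "\<lambda>\<delta> n. nat \<lfloor>\<delta> * real n\<rfloor> + 1"
  have v: "(\<lambda>n. real n powr \<alpha> * d (?v \<delta> n)) \<longlonglongrightarrow> 0" if "\<delta> > 0" for \<delta>
  proof -
    have "(\<lambda>n. real (nat \<lfloor>\<delta> * real n\<rfloor>) / real n + 1 / real n) \<longlonglongrightarrow> \<delta> + 0"
      by (intro tendsto_add tendsto_nat_floor_div that lim_1_over_n)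
    then have "(\<lambda>n. real (?v \<delta> n) / real n) \<longlonglongrightarrow> \<delta>"
      by (simp add: add_divide_distrib add.commute)
    from tendsto_powr_mult_reindex[OF this that d] show ?thesis by simp
  qed
  fix l
  {
    assume "l < a"
    \<comment> \<open>Reading \<open>s\<close> near index \<open>(1 + \<delta>) n\<close> costs the
      factor \<open>(1 + \<delta>) powr (- \<alpha>)\<close>; by continuity at 0 some
      \<open>\<delta> > 0\<close> keeps the limit above \<open>l\<close>.\<close>
    have "((\<lambda>\<delta>. (1 + \<delta>) powr (- \<alpha>) * a) \<longlongrightarrow> (1 + 0) powr (- \<alpha>) * a) (at_right 0)"
      by (intro tendsto_intros) auto
    then have "eventually (\<lambda>\<delta>. l < (1 + \<delta>) powr (- \<alpha>) * a) (at_right 0)"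
      using \<open>l < a\<close> order_tendstoD(1) by fastforce
    then have "eventually (\<lambda>\<delta>. l < (1 + \<delta>) powr (- \<alpha>) * a \<and> 0 < \<delta>) (at_right 0)"
      by (intro eventually_conj eventually_at_right_less)
    then obtain \<delta> where \<delta>: "l < (1 + \<delta>) powr (- \<alpha>) * a" "\<delta> > 0"
      using eventually_happens'[OF trivial_limit_at_right_real] by blast
    let ?u = "\<lambda>n. n + nat \<lfloor>\<delta> * real n\<rfloor>"
    have "(\<lambda>n. 1 + real (nat \<lfloor>\<delta> * real n\<rfloor>) / real n) \<longlonglongrightarrow> 1 + \<delta>"
      by (intro tendsto_add tendsto_nat_floor_div \<delta> tendsto_const)
    moreover have "eventually (\<lambda>n. 1 + real (nat \<lfloor>\<delta> * real n\<rfloor>) / real n = real (?u n) / real n) sequentially"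
      using eventually_gt_at_top[of 0] by eventually_elim (simp add: field_simps)
    ultimately have "(\<lambda>n. real (?u n) / real n) \<longlonglongrightarrow> 1 + \<delta>"
      by (rule Lim_transform_eventually)
    from tendsto_powr_mult_reindex[OF this _ s]
    have "(\<lambda>n. real n powr \<alpha> * s (?u n)) \<longlonglongrightarrow> (1 + \<delta>) powr (- \<alpha>) * a"
      using \<delta> by simp
    from tendsto_diff[OF this v[OF \<delta>(2)]]
    have "(\<lambda>n. real n powr \<alpha> * s (?u n) - real n powr \<alpha> * d (?v \<delta> n)) \<longlonglongrightarrow> (1 + \<delta>) powr (- \<alpha>) * a"
      by simp
    then have "eventually (\<lambda>n. l < real n powr \<alpha> * s (?u n) - real n powr \<alpha> * d (?v \<delta> n)) sequentially"
      using \<delta> order_tendstoD(1) by blast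
    then show "eventually (\<lambda>n. l < real n powr \<alpha> * t n) sequentially"
      using eventually_gt_at_top[of 0]
    proof eventually_elim
      case (elim n)
      have "s (?u n) \<le> t n + d (?v \<delta> n)"
        using s_le[of n "?v \<delta> n"] elim by simp
      then have "real n powr \<alpha> * s (?u n) \<le> real n powr \<alpha> * (t n + d (?v \<delta> n))"
        by (intro mult_left_mono) auto
      then show ?case
        using elim by (simp add: distrib_left)
    qed
  next
    assume "a < l"
    have "((\<lambda>\<delta>. (1 - \<delta>) powr (- \<alpha>) * a) \<longlongrightarrow> (1 - 0) powr (- \<alpha>) * a) (at_right 0)"
      by (intro tendsto_intros) auto
    then have "eventually (\<lambda>\<delta>. (1 - \<delta>) powr (- \<alpha>) * a < l) (at_right 0)"
      using \<open>a < l\<close> order_tendstoD(2) by fastforce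
    then have "eventually (\<lambda>\<delta>. (1 - \<delta>) powr (- \<alpha>) * a < l \<and> 0 < \<delta> \<and> \<delta> < 1) (at_right 0)"
      using eventually_at_right_real[OF zero_less_one] by eventually_elim simp
    then obtain \<delta> where \<delta>: "(1 - \<delta>) powr (- \<alpha>) * a < l" "\<delta> > 0" "\<delta> < 1"
      using eventually_happens'[OF trivial_limit_at_right_real] by blast
    \<comment> \<open>Here the main index is shortened instead of lengthened;
      \<open>\<delta> < 1\<close> keeps it positive.\<close>
    let ?u = "\<lambda>n. n - nat \<lfloor>\<delta> * real n\<rfloor>"
    have less: "nat \<lfloor>\<delta> * real n\<rfloor> < n" if "n > 0" for n
    proof -
      have "\<delta> * real n < 1 * real n"
        using \<delta> that by (intro mult_strict_right_mono) auto
      moreover have "0 \<le> \<delta> * real n"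
        using \<delta> by simp
      ultimately show ?thesis by linarith
    qed
    have "(\<lambda>n. 1 - real (nat \<lfloor>\<delta> * real n\<rfloor>) / real n) \<longlonglongrightarrow> 1 - \<delta>"
      by (intro tendsto_diff tendsto_nat_floor_div \<delta> tendsto_const)
    moreover have "eventually (\<lambda>n. 1 - real (nat \<lfloor>\<delta> * real n\<rfloor>) / real n = real (?u n) / real n) sequentially"
      using eventually_gt_at_top[of 0]
    proof eventually_elim
      case (elim n)
      then show ?case
        using less[OF elim] by (simp add: field_simps)
    qed
    ultimately have "(\<lambda>n. real (?u n) / real n) \<longlonglongrightarrow> 1 - \<delta>"
      by (rule Lim_transform_eventually)
    from tendsto_powr_mult_reindex[OF this _ s]
    have "(\<lambda>n. real n powr \<alpha> * s (?u n)) \<longlonglongrightarrow> (1 - \<delta>) powr (- \<alpha>) * a"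
      using \<delta> by simp
    from tendsto_add[OF this v[OF \<delta>(2)]]
    have "(\<lambda>n. real n powr \<alpha> * s (?u n) + real n powr \<alpha> * d (?v \<delta> n)) \<longlonglongrightarrow> (1 - \<delta>) powr (- \<alpha>) * a"
      by simp
    then have "eventually (\<lambda>n. real n powr \<alpha> * s (?u n) + real n powr \<alpha> * d (?v \<delta> n) < l) sequentially"
      using \<delta> order_tendstoD(2) by blast
    then show "eventually (\<lambda>n. real n powr \<alpha> * t n < l) sequentially"
      using eventually_gt_at_top[of 0]
    proof eventually_elim
      case (elim n)
      have "t n \<le> s (?u n) + d (?v \<delta> n)"
        using t_le[of "?u n" "?v \<delta> n"] less[OF elim(2)] by simp
      then have "real n powr \<alpha> * t n \<le> real n powr \<alpha> * (s (?u n) + d (?v \<delta> n))"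
        by (intro mult_left_mono) auto
      then show ?case
        using elim by (simp add: distrib_left)
    qed
  }
qed

section \<open>Resolvents of extensions described by a boundary triplet\<close>

lemma resolvent_in_graph:
  assumes "z \<in> resolvent_set T"
  shows "(resolvent T z h, h + z *\<^sub>C resolvent T z h) \<in> T"
  unfolding resolvent_def
  by (rule theI'[where P = "\<lambda>f. (f, h + z *\<^sub>C f) \<in> T"]) (use assms in \<open>simp add: resolvent_set_def\<close>)

lemma resolvent_eqI:
  assumes "z \<in> resolvent_set T" "(f, h + z *\<^sub>C f) \<in> T"
  shows "resolvent T z h = f"
  using assms unfolding resolvent_set_def resolvent_def by (auto intro: the1_equality)

lemma bounded_clinear_resolvent: "z \<in> resolvent_set T \<Longrightarrow> bounded_clinear (resolvent T z)"
  by (simp add: resolvent_set_def)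

text \<open>One inclusion of the rule that the adjoint of a resolvent at \<open>z\<close> is the
  resolvent of the adjoint at \<open>cnj z\<close>: each \<open>(f, f')\<close> in \<open>T\<close>
  has \<open>f\<close> as the resolvent of \<open>f' - z *\<^sub>C f\<close>.\<close>

lemma resolvent_adjoint_in_adjoint_op:
  assumes z: "z \<in> resolvent_set T" and R: "\<And>x y. cinner (resolvent T z x) y = cinner x (R y)"
  shows "(R k, k + cnj z *\<^sub>C R k) \<in> adjoint_op T"
proof -
  have "cinner f' (R k) = cinner f (k + cnj z *\<^sub>C R k)" if "(f, f') \<in> T" for f f'
  proof -
    from that have "resolvent T z (f' - z *\<^sub>C f) = f"
      by (intro resolvent_eqI[OF z]) simp
    then have "cinner f k = cinner (f' - z *\<^sub>C f) (R k)"
      using R[of "f' - z *\<^sub>C f" k] by simp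
    then show ?thesis
      by (simp add: cinner_diff_left cinner_scaleC_left cinner_add_right cinner_scaleC_right)
  qed
  then show ?thesis
    unfolding adjoint_op_def by blast
qed

locale symmetric_triplet =
  fixes A :: "'h::chilbert_space graph" and \<Gamma>0 \<Gamma>1 :: "'h \<Rightarrow> 'k::chilbert_space"
  assumes symmetric: "symmetric_op A" and triplet: "boundary_triplet A \<Gamma>0 \<Gamma>1"
begin

lemma \<Gamma>_linear:
  assumes "f \<in> Domain (adjoint_op A)" "g \<in> Domain (adjoint_op A)"
  shows "\<Gamma>0 (f + g) = \<Gamma>0 f + \<Gamma>0 g" "\<Gamma>1 (f + g) = \<Gamma>1 f + \<Gamma>1 g"
    "\<Gamma>0 (c *\<^sub>C f) = c *\<^sub>C \<Gamma>0 f" "\<Gamma>1 (c *\<^sub>C f) = c *\<^sub>C \<Gamma>1 f"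
  using triplet assms unfolding boundary_triplet_def by blast+

lemma green:
  assumes "(f, f') \<in> adjoint_op A" "(g, g') \<in> adjoint_op A"
  shows "cinner f' g - cinner f g' = cinner (\<Gamma>1 f) (\<Gamma>0 g) - cinner (\<Gamma>0 f) (\<Gamma>1 g)"
  using triplet assms unfolding boundary_triplet_def by blast

lemma \<Gamma>_surj:
  obtains f f' where "(f, f') \<in> adjoint_op A" "\<Gamma>0 f = u" "\<Gamma>1 f = v"
proof -
  have "(v, u) \<in> (\<lambda>f. (\<Gamma>1 f, \<Gamma>0 f)) ` Domain (adjoint_op A)"
    using triplet by (simp add: boundary_triplet_def)
  then show ?thesis using that by auto
qed

lemma subset_adjoint_op: "A \<subseteq> adjoint_op A"
  using symmetric unfolding symmetric_op_def adjoint_op_def by blast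

text \<open>Against \<open>A\<close> the left side of Green's identity vanishes, while the boundary
  values of the second argument are arbitrary.\<close>

lemma \<Gamma>_eq_0:
  assumes "(f, f') \<in> A"
  shows "\<Gamma>0 f = 0" "\<Gamma>1 f = 0"
proof -
  have "cinner (\<Gamma>1 f) (\<Gamma>0 g) = cinner (\<Gamma>0 f) (\<Gamma>1 g)" if "(g, g') \<in> adjoint_op A" for g g'
  proof -
    have "cinner f' g = cinner f g'"
      using that assms unfolding adjoint_op_def by blast
    then show ?thesis
      using green[OF _ that, of f f'] assms subset_adjoint_op by auto
  qed
  then have *: "cinner (\<Gamma>1 f) u = cinner (\<Gamma>0 f) v" for u v
    using \<Gamma>_surj[of u v] by metis
  show "\<Gamma>0 f = 0"
    by (rule cinner_eqI) (use *[of 0] in simp)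
  show "\<Gamma>1 f = 0"
    by (rule cinner_eqI) (use *[of _ 0] in simp)
qed

text \<open>Taking adjoints reverses this inclusion, so boundary values make sense on the domain of
  the adjoint of an extension.\<close>

lemma subset_extension_op:
  assumes "operator B"
  shows "A \<subseteq> extension_op A \<Gamma>0 \<Gamma>1 B"
proof -
  have "(0, 0) \<in> B"
    using assms complex_vector.subspace_0[of B] by (simp add: operator_def zero_prod_def)
  then show ?thesis
    using subset_adjoint_op \<Gamma>_eq_0 by (auto simp: extension_op_def)
qed

text \<open>One inclusion of the rule that the adjoint of the extension for \<open>B\<close> is the
  extension for the adjoint of \<open>B\<close>: Green's identity is tested on elements with
  prescribed boundary values in \<open>B\<close>.\<close>

lemma \<Gamma>_adjoint_extension:
  assumes B: "operator B" and g: "(g, g') \<in> adjoint_op (extension_op A \<Gamma>0 \<Gamma>1 B)"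
  shows "(g, g') \<in> adjoint_op A" "(\<Gamma>0 g, \<Gamma>1 g) \<in> adjoint_op B"
proof -
  show gA: "(g, g') \<in> adjoint_op A"
    using g subset_extension_op[OF B] unfolding adjoint_op_def by blast
  have "cinner v (\<Gamma>0 g) = cinner u (\<Gamma>1 g)" if uv: "(u, v) \<in> B" for u v
  proof -
    obtain f f' where f: "(f, f') \<in> adjoint_op A" "\<Gamma>0 f = u" "\<Gamma>1 f = v"
      by (rule \<Gamma>_surj)
    then have "(f, f') \<in> extension_op A \<Gamma>0 \<Gamma>1 B"
      using uv by (simp add: extension_op_def)
    then have "cinner f' g = cinner f g'"
      using g unfolding adjoint_op_def by blast
    then show ?thesis
      using green[OF f(1) gA] f by simp
  qed
  then show "(\<Gamma>0 g, \<Gamma>1 g) \<in> adjoint_op B"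
    unfolding adjoint_op_def by blast
qed

text \<open>Green's identity against an element with boundary values \<open>(k, cnj w k)\<close> shows that the
  operator is weakly bounded.\<close>

lemma bounded_clinear_boundary_map:
  assumes G: "bounded_clinear G" and graph: "\<And>h. (G h, h + z *\<^sub>C G h) \<in> adjoint_op A"
  shows "bounded_clinear (\<lambda>h. \<Gamma>1 (G h) - w *\<^sub>C \<Gamma>0 (G h))"
proof (rule bounded_clinear_of_weakly_bounded)
  have dom: "G h \<in> Domain (adjoint_op A)" for h
    using graph by blast
  show "\<Gamma>1 (G (x + y)) - w *\<^sub>C \<Gamma>0 (G (x + y)) =
      (\<Gamma>1 (G x) - w *\<^sub>C \<Gamma>0 (G x)) + (\<Gamma>1 (G y) - w *\<^sub>C \<Gamma>0 (G y))" for x y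
    by (simp add: bounded_clinear_add[OF G] \<Gamma>_linear[OF dom dom] scaleC_add_right)
  show "\<Gamma>1 (G (c *\<^sub>C x)) - w *\<^sub>C \<Gamma>0 (G (c *\<^sub>C x)) =
      c *\<^sub>C (\<Gamma>1 (G x) - w *\<^sub>C \<Gamma>0 (G x))" for c x
    by (simp add: bounded_clinear_scaleC[OF G] \<Gamma>_linear[OF dom dom] scaleC_scaleC
        complex_vector.scale_right_diff_distrib mult.commute)
  fix k
  obtain e e' where e: "(e, e') \<in> adjoint_op A" "\<Gamma>0 e = k" "\<Gamma>1 e = cnj w *\<^sub>C k"
    by (rule \<Gamma>_surj)
  obtain K where K: "K > 0" "\<And>x. norm (G x) \<le> K * norm x"
    using bounded_clinear_bound[OF G] by blast
  define C where "C = (1 + cmod z * K) * norm e + K * norm e'"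
  have "cmod (cinner (\<Gamma>1 (G h) - w *\<^sub>C \<Gamma>0 (G h)) k) \<le> C * norm h" for h
  proof -
    have "cinner (\<Gamma>1 (G h) - w *\<^sub>C \<Gamma>0 (G h)) k = cinner (h + z *\<^sub>C G h) e - cinner (G h) e'"
      using green[OF graph[of h] e(1)]
      by (simp add: e cinner_diff_left cinner_scaleC_left cinner_scaleC_right)
    also have "cmod \<dots> \<le> norm (h + z *\<^sub>C G h) * norm e + norm (G h) * norm e'"
      by (intro order_trans[OF norm_triangle_ineq4] add_mono cmod_cinner_le)
    also have "\<dots> \<le> (norm h + cmod z * (K * norm h)) * norm e + (K * norm h) * norm e'"
    proof (intro add_mono mult_right_mono K norm_ge_zero)
      have "norm (h + z *\<^sub>C G h) \<le> norm h + cmod z * norm (G h)"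
        by (rule order_trans[OF norm_triangle_ineq]) (simp add: norm_scaleC)
      also have "cmod z * norm (G h) \<le> cmod z * (K * norm h)"
        by (intro mult_left_mono K) simp
      finally show "norm (h + z *\<^sub>C G h) \<le> norm h + cmod z * (K * norm h)" by simp
    qed
    also have "\<dots> = C * norm h"
      by (simp add: C_def algebra_simps)
    finally show ?thesis .
  qed
  then show "\<exists>C. \<forall>h. cmod (cinner (\<Gamma>1 (G h) - w *\<^sub>C \<Gamma>0 (G h)) k) \<le> C * norm h"
    by blast
qed

text \<open>The classical Krein formula refers to a fixed extension and its Weyl function; pairing
  the two resolvents directly by Green's identity involves only the two given extensions.\<close>

lemma resolvent_difference_factorization:
  assumes B1: "operator B1"
    and z1: "z \<in> resolvent_set (extension_op A \<Gamma>0 \<Gamma>1 B1)"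
    and z2: "z \<in> resolvent_set (extension_op A \<Gamma>0 \<Gamma>1 B2)"
    and \<zeta>1: "\<zeta> \<in> resolvent_set B1" and \<zeta>2: "\<zeta> \<in> resolvent_set B2"
  obtains X Y where "bounded_clinear X" "bounded_clinear Y"
    "\<And>h. resolvent (extension_op A \<Gamma>0 \<Gamma>1 B1) z h - resolvent (extension_op A \<Gamma>0 \<Gamma>1 B2) z h =
      X (resolvent B1 \<zeta> (Y h) - resolvent B2 \<zeta> (Y h))"
proof -
  let ?R1 = "resolvent (extension_op A \<Gamma>0 \<Gamma>1 B1) z"
  let ?R2 = "resolvent (extension_op A \<Gamma>0 \<Gamma>1 B2) z"
  obtain R where R: "bounded_clinear R" "\<And>x y. cinner (?R1 x) y = cinner x (R y)"
    using adjoint_exists[OF bounded_clinear_resolvent[OF z1]] by blast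
  define Y where "Y h = \<Gamma>1 (?R2 h) - \<zeta> *\<^sub>C \<Gamma>0 (?R2 h)" for h
  define Z where "Z k = \<Gamma>1 (R k) - cnj \<zeta> *\<^sub>C \<Gamma>0 (R k)" for k
  have R2: "(?R2 h, h + z *\<^sub>C ?R2 h) \<in> adjoint_op A" "(\<Gamma>0 (?R2 h), \<Gamma>1 (?R2 h)) \<in> B2" for h
    using resolvent_in_graph[OF z2, of h] by (auto simp: extension_op_def)
  note Radj = \<Gamma>_adjoint_extension[OF B1 resolvent_adjoint_in_adjoint_op[OF z1 R(2)]]
  have Y: "bounded_clinear Y"
    unfolding Y_def by (rule bounded_clinear_boundary_map[OF bounded_clinear_resolvent[OF z2] R2(1)])
  have Z: "bounded_clinear Z"
    unfolding Z_def by (rule bounded_clinear_boundary_map[OF R(1) Radj(1)])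
  \<comment> \<open>\<open>Z\<close> maps into the boundary space, where weak boundedness can be
    tested; its adjoint is the factor leading back to the original space.\<close>
  obtain X where X: "bounded_clinear X" "\<And>x y. cinner (Z x) y = cinner x (X y)"
    using adjoint_exists[OF Z] by blast
  have "?R1 h - ?R2 h = X (resolvent B1 \<zeta> (Y h) - resolvent B2 \<zeta> (Y h))" for h
  proof (rule cinner_eqI)
    fix k
    define u v p q where "u = \<Gamma>0 (?R2 h)" and "v = \<Gamma>1 (?R2 h)" and "p = \<Gamma>0 (R k)" and "q = \<Gamma>1 (R k)"
    have "cinner (?R1 h) k - cinner (?R2 h) k = cinner (h + z *\<^sub>C ?R2 h) (R k) - cinner (?R2 h) (k + cnj z *\<^sub>C R k)"
      by (simp add: R cinner_add_left cinner_add_right cinner_scaleC_left cinner_scaleC_right)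
    also have "\<dots> = cinner v p - cinner u q"
      using green[OF R2(1) Radj(1)] by (simp add: u_def v_def p_def q_def)
    \<comment> \<open>The shifts cancel: both terms change by
      \<open>\<zeta> * cinner u p\<close>.\<close>
    also have "\<dots> = cinner (Y h) p - cinner u (Z k)"
      by (simp add: Y_def Z_def u_def v_def p_def q_def cinner_diff_left cinner_diff_right
          cinner_scaleC_left cinner_scaleC_right)
    also have "u = resolvent B2 \<zeta> (Y h)"
      using R2(2)[of h] by (intro resolvent_eqI[OF \<zeta>2, symmetric]) (simp add: Y_def u_def)
    \<comment> \<open>\<open>(p, q)\<close> lies in the adjoint of \<open>B1\<close>, so it can be
      paired with the element of \<open>B1\<close> over the resolvent of \<open>Y h\<close>.\<close>
    also have "cinner (Y h) p = cinner (resolvent B1 \<zeta> (Y h)) (Z k)"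
    proof -
      have "cinner (Y h + \<zeta> *\<^sub>C resolvent B1 \<zeta> (Y h)) p = cinner (resolvent B1 \<zeta> (Y h)) q"
        using Radj(2)[of k] resolvent_in_graph[OF \<zeta>1, of "Y h"]
        unfolding adjoint_op_def p_def q_def by blast
      then show ?thesis
        by (simp add: Z_def p_def[symmetric] q_def[symmetric] cinner_add_left cinner_scaleC_left
            cinner_diff_right cinner_scaleC_right eq_diff_eq)
    qed
    finally show "cinner (?R1 h - ?R2 h) k = cinner (X (resolvent B1 \<zeta> (Y h) - resolvent B2 \<zeta> (Y h))) k"
      by (subst (2) cinner_commute)
        (simp add: X(2)[symmetric] cinner_diff_left cinner_diff_right cinner_commute[of "Z k"])
  qed
  then show ?thesis using X(1) Y that by blast
qed

end

theorem corollary4p8: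
  fixes A :: "'h::chilbert_space graph"
    and \<Gamma>0 \<Gamma>1 :: "'h \<Rightarrow> 'k::chilbert_space"
    and B1 B2 :: "'k graph"
    and z0 \<zeta> :: complex
    and \<alpha> a :: real
  assumes "separable_space (euclidean :: 'h topology)"
    and "A \<in> closed_dd_operators" and "symmetric_op A" and "equal_deficiency_indices A"
    and "boundary_triplet A \<Gamma>0 \<Gamma>1"
    and "B1 \<in> closed_dd_operators" and "B2 \<in> closed_dd_operators"
    and "z0 \<in> resolvent_set (extension_op A \<Gamma>0 \<Gamma>1 B1) \<inter> resolvent_set (extension_op A \<Gamma>0 \<Gamma>1 B2)"
    and "\<zeta> \<in> resolvent_set B1 \<inter> resolvent_set B2"
    and "\<alpha> > 0" and "a > 0"
    and "compact_op (resolvent (extension_op A \<Gamma>0 \<Gamma>1 B1) z0)"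
    and "(\<lambda>n. real n powr \<alpha> * singular_number (resolvent (extension_op A \<Gamma>0 \<Gamma>1 B1) z0) n)
           \<longlonglongrightarrow> a"
    and "compact_op (\<lambda>x. resolvent B1 \<zeta> x - resolvent B2 \<zeta> x)"
    and "(\<lambda>n. real n powr \<alpha> * singular_number (\<lambda>x. resolvent B1 \<zeta> x - resolvent B2 \<zeta> x) n)
           \<longlonglongrightarrow> 0"
  shows "compact_op (resolvent (extension_op A \<Gamma>0 \<Gamma>1 B2) z0) \<and>
         (\<lambda>n. real n powr \<alpha> * singular_number (resolvent (extension_op A \<Gamma>0 \<Gamma>1 B2) z0) n)
           \<longlonglongrightarrow> a"
proof -
  let ?R1 = "resolvent (extension_op A \<Gamma>0 \<Gamma>1 B1) z0"
  let ?R2 = "resolvent (extension_op A \<Gamma>0 \<Gamma>1 B2) z0"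
  let ?K = "\<lambda>x. resolvent B1 \<zeta> x - resolvent B2 \<zeta> x"
  interpret symmetric_triplet A \<Gamma>0 \<Gamma>1
    by unfold_locales (fact assms)+
  have "operator B1"
    using assms(6) by (simp add: closed_dd_operators_def)
  then obtain X Y where X: "bounded_clinear X" and Y: "bounded_clinear Y"
    and diff: "\<And>h. ?R1 h - ?R2 h = X (?K (Y h))"
    using resolvent_difference_factorization[of B1 z0 B2 \<zeta>] assms(8,9) by blast
  \<comment> \<open>The Ky Fan inequality is applied in both directions, with \<open>D\<close> added
    to \<open>?R2\<close> and its negative \<open>E\<close> added to \<open>?R1\<close>.\<close>
  define D where "D h = X (?K (Y h))" for h
  define E where "E h = - X (?K (Y h))" for h
  have mX: "bounded_clinear (\<lambda>k. - X k)"
    using bounded_clinear_minus[OF bounded_clinear_minus[OF X X] X] by simp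
  have D: "compact_op D" and E: "compact_op E"
    using compact_op_compose[OF assms(14) X Y] compact_op_compose[OF assms(14) mX Y]
    by (simp_all add: D_def[abs_def] E_def[abs_def])
  have R2: "?R2 = (\<lambda>h. ?R1 h + E h)" and R1: "?R1 = (\<lambda>h. ?R2 h + D h)"
    using diff by (auto simp: D_def E_def algebra_simps)
  have compact: "compact_op ?R2"
    by (subst R2) (rule compact_op_plus[OF assms(12) E])
  obtain a' b' where "a' > 0" and a': "\<And>k. norm (X k) \<le> a' * norm k"
    and "b' > 0" and b': "\<And>h. norm (Y h) \<le> b' * norm h"
    using bounded_clinear_bound[OF X] bounded_clinear_bound[OF Y] by metis
  \<comment> \<open>A common majorant for \<open>D\<close> and \<open>E\<close>, so that their
    singular numbers need not be compared with each other.\<close>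
  define d where "d n = a' * b' * singular_number ?K n" for n
  have D_le: "singular_number D n \<le> d n" for n
    unfolding D_def[abs_def] d_def
    by (rule singular_number_compose_le[OF assms(14) X Y a' b'])
      (use \<open>a' > 0\<close> \<open>b' > 0\<close> in simp_all)
  have E_le: "singular_number E n \<le> d n" for n
    unfolding E_def[abs_def] d_def
    by (rule singular_number_compose_le[OF assms(14) mX Y _ b'])
      (use \<open>a' > 0\<close> \<open>b' > 0\<close> a' in simp_all)
  have "(\<lambda>n. real n powr \<alpha> * singular_number ?R2 n) \<longlonglongrightarrow> a"
  proof (rule tendsto_powr_mult_perturbation[OF _ _ assms(13)])
    fix m n :: nat assume mn: "1 \<le> m" "1 \<le> n"
    show "singular_number ?R2 (m + n - 1) \<le> singular_number ?R1 m + d n"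
      using singular_number_plus_le[OF assms(12) E mn] E_le[of n] by (subst R2) linarith
    show "singular_number ?R1 (m + n - 1) \<le> singular_number ?R2 m + d n"
      using singular_number_plus_le[OF compact D mn] D_le[of n] by (subst R1) linarith
  next
    show "(\<lambda>n. real n powr \<alpha> * d n) \<longlonglongrightarrow> 0"
      using tendsto_mult_left[OF assms(15), of "a' * b'"] by (simp add: d_def mult_ac)
  qed
  with compact show ?thesis by blast
qed

end
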